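(* The map $\varphi_0$ defined by $\varphi_0(x)=x^\perp\cap Q_0$ for every point $x\in Q\setminus Q_0$, and $\varphi_0(\hat l)=\{x^\perp\cap Q_0: x\in\hat l\}$ for every line $\hat l$ of $\hat{\mathcal X}$, is well defined (i.e. $x^\perp\cap Q_0$ is an elliptic ovoid of $Q_0$ and $\varphi_0(\hat l)$ is a rosette based at $l^\infty$) and is a $2$-fold covering from $\hat{\mathcal X}$ to $\mathcal X$.
   Context: Let $q=2^n$, $V=V(6,q)$, and let $Q=Q^-(5,q)$ be the set of singular points of a non-degenerate quadratic form $f$ of Witt index $2$ on $V$, viewed as a generalized quadrangle of order $(q,q^2)$ whose lines are the totally singular lines of $\mathrm{PG}(V)$. Let $\perp$ denote the polarity of $\mathrm{PG}(V)$ defined by the bilinear form associated with $f$. Let $H_0$ be a hyperplane of $\mathrm{PG}(V)$ with $Q_0:=Q\cap H_0\cong Q(4,q)$ a parabolic quadric, and let $n_0:=H_0^\perp$ (the nucleus of $Q_0$, a point not on $Q$). An elliptic ovoid of $Q_0$ is a set $X=S\cap Q_0$ where $S$ is a $3$-dimensional projective subspace of $H_0$ meeting $Q_0$ in an elliptic quadric $Q^-(3,q)$. Two distinct elliptic ovoids meet in one point or in a conic; they are tangent if they meet in exactly one point. A rosette based at a point $p\in Q_0$ is a set of $q$ elliptic ovoids pairwise meeting exactly in $\{p\}$. The geometry $\mathcal X$ has the elliptic ovoids of $Q_0$ as points, the rosettes as lines, incidence being membership. The affine geometry $\hat{\mathcal X}$ has as points the points of $Q\setminus Q_0$ and as lines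 the sets $\hat l=l\setminus\{l^\infty\}$, where $l$ ranges over the lines of $Q$ not contained in $Q_0$ and $l^\infty:=l\cap Q_0$; incidence is inclusion. A morphism of rank-2 geometries (mapping points to points, lines to lines, preserving incidence) is a covering if for every point $x$ and line $L$ it induces bijections from the points of $L$ onto the points of the image of $L$ and from the lines through $x$ onto the lines through the image of $x$; it is $2$-fold if all fibres have size $2$. *)

theory Defs
  imports "HOL-Analysis.Analysis" "HOL-Library.Numeral_Type"
begin

text \<open>Vectors of V = V(6,q) are elements of 'a^6 for a finite field 'a.
  Projective subspaces of PG(V) are represented by vector subspaces of V
  (projective dimension = vector dimension - 1); a projective point is a
  1-dimensional vector subspace.\<close>

type_synonym 'a vec6 = "'a ^ 6"
type_synonym 'a ppoint = "'a vec6 set"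

definition pg_points :: "'a::field ppoint set" where
  "pg_points = {W. vec.subspace W \<and> vec.dim W = 1}"

definition polar :: "('a::field vec6 \<Rightarrow> 'a) \<Rightarrow> 'a vec6 \<Rightarrow> 'a vec6 \<Rightarrow> 'a" where
  "polar f u v = f (u + v) - f u - f v"

definition is_quadratic_form :: "('a::field vec6 \<Rightarrow> 'a) \<Rightarrow> bool" where
  "is_quadratic_form f \<longleftrightarrow>
     (\<forall>c v. f (c *s v) = c^2 * f v) \<and>
     (\<forall>u w v. polar f (u + w) v = polar f u v + polar f w v) \<and>
     (\<forall>c u v. polar f (c *s u) v = c * polar f u v)"

definition nondeg_on :: "('a::field vec6 \<Rightarrow> 'a) \<Rightarrow> 'a vec6 set \<Rightarrow> bool" where
  "nondeg_on f W \<longleftrightarrow>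
     \<not> (\<exists>w\<in>W. w \<noteq> 0 \<and> f w = 0 \<and> (\<forall>u\<in>W. polar f w u = 0))"

definition totally_singular :: "('a::field vec6 \<Rightarrow> 'a) \<Rightarrow> 'a vec6 set \<Rightarrow> bool" where
  "totally_singular f W \<longleftrightarrow> vec.subspace W \<and> (\<forall>w\<in>W. f w = 0)"

definition witt_index_on :: "('a::field vec6 \<Rightarrow> 'a) \<Rightarrow> 'a vec6 set \<Rightarrow> nat \<Rightarrow> bool" where
  "witt_index_on f W k \<longleftrightarrow>
     (\<exists>U. U \<subseteq> W \<and> totally_singular f U \<and> vec.dim U = k) \<and>
     (\<forall>U. U \<subseteq> W \<and> totally_singular f U \<longrightarrow> vec.dim U \<le> k)"

definition perp :: "('a::field vec6 \<Rightarrow> 'a) \<Rightarrow> 'a vec6 set \<Rightarrow> 'a vec6 set" where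
  "perp f X = {v. \<forall>u\<in>X. polar f u v = 0}"

definition quadric :: "('a::field vec6 \<Rightarrow> 'a) \<Rightarrow> 'a ppoint set" where
  "quadric f = {p \<in> pg_points. \<forall>v\<in>p. f v = 0}"

definition pts_in :: "'a::field vec6 set \<Rightarrow> 'a ppoint set" where
  "pts_in W = {p \<in> pg_points. p \<subseteq> W}"

definition quadric_lines :: "('a::field vec6 \<Rightarrow> 'a) \<Rightarrow> 'a ppoint set set" where
  "quadric_lines f = {pts_in L | L. totally_singular f L \<and> vec.dim L = 2}"

definition Q0 :: "('a::field vec6 \<Rightarrow> 'a) \<Rightarrow> 'a vec6 set \<Rightarrow> 'a ppoint set" where
  "Q0 f H0 = quadric f \<inter> pts_in H0"

text \<open>Elliptic ovoids of Q_0: S \<inter> Q_0 for a solid S of H_0 (4-dim vector subspace)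
  meeting Q_0 in an elliptic quadric Q^-(3,q), i.e. f restricted to S is
  non-degenerate of Witt index 1.\<close>
definition elliptic_ovoids :: "('a::field vec6 \<Rightarrow> 'a) \<Rightarrow> 'a vec6 set \<Rightarrow> 'a ppoint set set" where
  "elliptic_ovoids f H0 =
     {pts_in S \<inter> Q0 f H0 | S. vec.subspace S \<and> S \<subseteq> H0 \<and> vec.dim S = 4 \<and>
        nondeg_on f S \<and> witt_index_on f S 1}"

definition rosette_at :: "('a::{field,finite} vec6 \<Rightarrow> 'a) \<Rightarrow> 'a vec6 set \<Rightarrow> 'a ppoint
    \<Rightarrow> 'a ppoint set set \<Rightarrow> bool" where
  "rosette_at f H0 p R \<longleftrightarrow>
     p \<in> Q0 f H0 \<and> R \<subseteq> elliptic_ovoids f H0 \<and> card R = CARD('a) \<and>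
     (\<forall>X\<in>R. \<forall>Y\<in>R. X \<noteq> Y \<longrightarrow> X \<inter> Y = {p})"

definition rosettes :: "('a::{field,finite} vec6 \<Rightarrow> 'a) \<Rightarrow> 'a vec6 set \<Rightarrow> 'a ppoint set set set" where
  "rosettes f H0 = {R. \<exists>p. rosette_at f H0 p R}"

text \<open>The affine geometry: points Q \ Q_0, lines l \ {l^inf} for lines l of Q not in Q_0.\<close>
definition aff_points :: "('a::field vec6 \<Rightarrow> 'a) \<Rightarrow> 'a vec6 set \<Rightarrow> 'a ppoint set" where
  "aff_points f H0 = quadric f - Q0 f H0"

definition aff_lines :: "('a::field vec6 \<Rightarrow> 'a) \<Rightarrow> 'a vec6 set \<Rightarrow> 'a ppoint set set" where
  "aff_lines f H0 = {l - Q0 f H0 | l. l \<in> quadric_lines f \<and> \<not> l \<subseteq> Q0 f H0}"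

definition geom_morphism ::
  "'p set \<Rightarrow> 'l set \<Rightarrow> ('p \<Rightarrow> 'l \<Rightarrow> bool) \<Rightarrow> 'q set \<Rightarrow> 'm set \<Rightarrow> ('q \<Rightarrow> 'm \<Rightarrow> bool)
   \<Rightarrow> ('p \<Rightarrow> 'q) \<Rightarrow> ('l \<Rightarrow> 'm) \<Rightarrow> bool" where
  "geom_morphism P L I P' L' I' fp fl \<longleftrightarrow>
     (\<forall>x\<in>P. fp x \<in> P') \<and> (\<forall>l\<in>L. fl l \<in> L') \<and>
     (\<forall>x\<in>P. \<forall>l\<in>L. I x l \<longrightarrow> I' (fp x) (fl l))"

definition geom_covering ::
  "'p set \<Rightarrow> 'l set \<Rightarrow> ('p \<Rightarrow> 'l \<Rightarrow> bool) \<Rightarrow> 'q set \<Rightarrow> 'm set \<Rightarrow> ('q \<Rightarrow> 'm \<Rightarrow> bool)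
   \<Rightarrow> ('p \<Rightarrow> 'q) \<Rightarrow> ('l \<Rightarrow> 'm) \<Rightarrow> bool" where
  "geom_covering P L I P' L' I' fp fl \<longleftrightarrow>
     geom_morphism P L I P' L' I' fp fl \<and>
     (\<forall>l\<in>L. bij_betw fp {x\<in>P. I x l} {y\<in>P'. I' y (fl l)}) \<and>
     (\<forall>x\<in>P. bij_betw fl {l\<in>L. I x l} {m\<in>L'. I' (fp x) m})"

definition two_fold ::
  "'p set \<Rightarrow> 'l set \<Rightarrow> 'q set \<Rightarrow> 'm set \<Rightarrow> ('p \<Rightarrow> 'q) \<Rightarrow> ('l \<Rightarrow> 'm) \<Rightarrow> bool" where
  "two_fold P L P' L' fp fl \<longleftrightarrow>
     (\<forall>y\<in>P'. card {x\<in>P. fp x = y} = 2) \<and> (\<forall>m\<in>L'. card {l\<in>L. fl l = m} = 2)"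

definition phi0_pt :: "('a::field vec6 \<Rightarrow> 'a) \<Rightarrow> 'a vec6 set \<Rightarrow> 'a ppoint \<Rightarrow> 'a ppoint set" where
  "phi0_pt f H0 x = pts_in (perp f x) \<inter> Q0 f H0"

definition phi0_line :: "('a::field vec6 \<Rightarrow> 'a) \<Rightarrow> 'a vec6 set \<Rightarrow> 'a ppoint set \<Rightarrow> 'a ppoint set set" where
  "phi0_line f H0 lh = phi0_pt f H0 ` lh"

end

theory Submission
  imports Defs
begin

text \<open>Let \<open>n\<^sub>0\<close> span \<open>H\<^sub>0\<^sup>\<perp>\<close>, scaled so that \<open>f n\<^sub>0 = 1\<close>. A point of \<open>Q - Q\<^sub>0\<close> has a unique spanning
  vector \<open>x\<close> with \<open>B n\<^sub>0 x = 1\<close>, and the transvection of \<open>n\<^sub>0\<close> maps \<open>x\<close> to \<open>x + n\<^sub>0\<close>. An elliptic solid \<open>S\<close>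
  is spanned by its singular points, and the nondegenerate plane \<open>S\<^sup>\<perp>\<close> contains \<open>n\<^sub>0\<close> and, because \<open>f\<close>
  has Witt index 2, a singular point; hence its singular points are \<open>x\<close> and \<open>x + n\<^sub>0\<close>, which gives the
  fibres on points. The ovoids of \<open>x\<close> and \<open>y\<close> meet in the singular points of \<open>W\<^sup>\<perp>\<close> with
  \<open>W = \<langle>x, y, n\<^sub>0\<rangle>\<close>, and they are tangent iff the radical \<open>x + y + B x y n\<^sub>0\<close> of \<open>W\<close> is singular, i.e. iff
  \<open>x\<close> is orthogonal to \<open>y\<close> or to \<open>y + n\<^sub>0\<close>. Thus all ovoids of a rosette based at \<open>p\<close> and containing
  the ovoid of \<open>x\<close> lift to the line joining \<open>x\<close> and \<open>p\<close>, and a rosette has one lift through each of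
  \<open>x\<close> and \<open>x + n\<^sub>0\<close>.\<close>

section \<open>Finite fields of characteristic 2\<close>

text \<open>Translation by 1 permutes the field, so the sum of all elements equals itself plus
  \<open>CARD('a)\<close> times 1. Hence \<open>2 ^ n\<close> vanishes in the field, and with it
  2.\<close>

lemma char2_of_card:
  assumes "CARD('a::{field,finite}) = 2 ^ n"
  shows "(1::'a) + 1 = 0"
proof -
  have "(\<Sum>x::'a\<in>UNIV. x) = (\<Sum>x::'a\<in>UNIV. x + 1)"
    by (rule sum.reindex_bij_witness[of _ "\<lambda>x. x + 1" "\<lambda>x. x - 1"]) auto
  then have "of_nat CARD('a) = (0::'a)"
    by (simp add: sum.distrib)
  then have "(2::'a) ^ n = 0" using assms by simp
  then show ?thesis by simp
qed

locale finite_field_char2 =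
  fixes T :: "'a::{field,finite} itself"
  assumes char2: "(1::'a) + 1 = 0"
begin

lemma two_eq_0 [simp]: "(2::'a) = 0"
  using char2 by simp

lemma add_self [simp]: "x + x = (0::'a)"
  using char2 by (metis distrib_left mult.right_neutral mult_zero_right)

lemma add_left_self [simp]: "x + (x + y) = (y::'a)"
  by (simp flip: add.assoc)

text \<open>These rules turn differences into sums, here for scalars and below for vectors. Library
  facts stated with subtraction, such as \<open>vec.span_insert\<close>, therefore appear later in
  the form \<open>z + a *s x = b *s p\<close>.\<close>

lemma uminus_eq [simp]: "- x = (x::'a)"
  by (simp add: minus_unique)

lemma minus_eq [simp]: "x - y = (x + y::'a)"
  by (metis diff_conv_add_uminus uminus_eq)

lemma add_eq_0_iff' [simp]: "x + y = 0 \<longleftrightarrow> x = (y::'a)"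
  by (metis add_self add_left_self add.right_neutral)

lemma vec_add_self [simp]: "v + v = (0 :: 'a ^ 'n)"
  by (simp add: vec_eq_iff)

lemma vec_add_left_self [simp]: "v + (v + w) = (w :: 'a ^ 'n)"
  by (simp add: vec_eq_iff)

lemma vec_minus_eq [simp]: "v - w = (v + w :: 'a ^ 'n)"
  by (simp add: vec_eq_iff)

lemma vec_add_eq_0_iff [simp]: "v + w = 0 \<longleftrightarrow> v = (w :: 'a ^ 'n)"
  by (metis vec_add_self vec_add_left_self add.right_neutral)

lemma vec_add_eq_iff: "v + w = u \<longleftrightarrow> v = (u + w :: 'a ^ 'n)"
  using diff_eq_eq[of v w u] by simp

lemma power2_add: "(x + y)\<^sup>2 = x\<^sup>2 + (y::'a)\<^sup>2"
  by (simp add: power2_eq_square algebra_simps)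

text \<open>Squaring is additive with trivial kernel, hence injective, and an injective map of a
  finite set into itself is onto.\<close>

lemma obtain_sqrt:
  obtains y where "y\<^sup>2 = (x::'a)"
proof -
  have "inj (\<lambda>y::'a. y\<^sup>2)"
  proof (rule injI)
    fix a b :: 'a
    assume "a\<^sup>2 = b\<^sup>2"
    then have "(a + b)\<^sup>2 = 0" by (simp add: power2_add)
    then show "a = b" by simp
  qed
  then have "surj (\<lambda>y::'a. y\<^sup>2)"
    by (simp add: finite_UNIV_inj_surj)
  then show thesis using that by (metis surjD)
qed

text \<open>The additive map \<open>P t = t^2 + t\<close> has kernel {0, 1}, so its image contains
  at least half of the field. If \<open>b\<close>, \<open>c\<close> and \<open>b + c\<close> were
  all outside the image, then the image and its cosets by \<open>b\<close> and \<open>c\<close>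
  would be three disjoint sets of that size.\<close>

lemma artin_schreier_index_2:
  fixes b c :: 'a
  assumes b: "\<And>t. t\<^sup>2 + t \<noteq> b" and c: "\<And>t. t\<^sup>2 + t \<noteq> c"
  obtains t where "t\<^sup>2 + t = b + c"
proof -
  define P where "P t = t\<^sup>2 + t" for t :: 'a
  have P_add: "P (s + t) = P s + P t" for s t
    by (simp add: P_def power2_add algebra_simps)
  have ker: "P t = 0 \<Longrightarrow> t = 0 \<or> t = 1" for t
  proof -
    assume "P t = 0"
    then have "t * (t + 1) = 0" by (simp add: P_def power2_eq_square algebra_simps)
    then show ?thesis by simp
  qed
  have fib: "card {s. P s = u} \<le> 2" for u
  proof (cases "\<exists>t. P t = u")
    case True
    then obtain t where t: "P t = u" by blast
    have "{s. P s = u} \<subseteq> {t, t + 1}"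
    proof
      fix s assume "s \<in> {s. P s = u}"
      then have "P (s + t) = 0" using t by (simp add: P_add)
      then consider "s + t = 0" | "s + t = 1" using ker by blast
      then show "s \<in> {t, t + 1}"
        by cases (auto, metis add.commute add_left_self)
    qed
    then have "card {s. P s = u} \<le> card {t, t + 1}" by (rule card_mono[rotated]) simp
    also have "\<dots> \<le> 2" by (simp add: card_insert_if)
    finally show ?thesis .
  next
    case False
    then have "{s. P s = u} = {}" by blast
    then show ?thesis by simp
  qed
  have "(UNIV::'a set) = (\<Union>u\<in>range P. {s. P s = u})" by auto
  then have "CARD('a) \<le> (\<Sum>u\<in>range P. card {s. P s = u})"
    by (metis card_UN_le finite)
  also have "\<dots> \<le> card (range P) * 2"
    using sum_bounded_above[of "range P" "\<lambda>u. card {s. P s = u}" 2] fib by simp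
  finally have large: "CARD('a) \<le> 2 * card (range P)" by simp
  show thesis
  proof (rule ccontr)
    assume no: "\<not> thesis"
    have bc: "b + c \<notin> range P"
    proof
      assume "b + c \<in> range P"
      then obtain t where "P t = b + c" by (metis imageE)
      then show False using no that unfolding P_def by blast
    qed
    let ?R = "range P" and ?Rb = "(+) b ` range P" and ?Rc = "(+) c ` range P"
    have cards: "card ?Rb = card ?R" "card ?Rc = card ?R"
      by (auto intro!: card_image)
    have d1: "?R \<inter> ?Rb = {}"
    proof -
      have "P s \<noteq> b + P t" for s t
      proof
        assume "P s = b + P t"
        then have "P (s + t) = b" by (simp add: P_add algebra_simps)
        then show False using b by (simp add: P_def)
      qed
      then show ?thesis by blast
    qed
    have d2: "(?R \<union> ?Rb) \<inter> ?Rc = {}"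
    proof -
      have "P s \<noteq> c + P t" for s t
      proof
        assume "P s = c + P t"
        then have "P (s + t) = c" by (simp add: P_add algebra_simps)
        then show False using c by (simp add: P_def)
      qed
      moreover have "b + P s \<noteq> c + P t" for s t
      proof
        assume "b + P s = c + P t"
        then have "P s = b + (c + P t)" by (metis add_left_self)
        then have "P (s + t) = b + c"
          by (simp add: P_add algebra_simps)
        then show False using bc by (metis rangeI)
      qed
      ultimately show ?thesis by blast
    qed
    have "card (?R \<union> ?Rb \<union> ?Rc) = 3 * card ?R"
      using d1 d2 cards by (simp add: card_Un_disjoint)
    moreover have "card (?R \<union> ?Rb \<union> ?Rc) \<le> CARD('a)" by (simp add: card_mono)
    moreover have "card ?R > 0" by (simp add: card_gt_0_iff)
    ultimately show False using large by simp
  qed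
qed

end

section \<open>Quadratic forms\<close>

locale char2_quadratic_form = finite_field_char2 T for T :: "'a::{field,finite} itself" +
  fixes f :: "'a ^ 6 \<Rightarrow> 'a"
  assumes quadratic: "is_quadratic_form f"
    and nondegenerate: "(\<And>v. polar f u v = 0) \<Longrightarrow> u = 0"
begin

abbreviation B :: "'a ^ 6 \<Rightarrow> 'a ^ 6 \<Rightarrow> 'a" where "B \<equiv> polar f"

lemma f_scale [simp]: "f (c *s v) = c\<^sup>2 * f v"
  using quadratic by (simp add: is_quadratic_form_def)

lemma f_0 [simp]: "f 0 = 0"
  using f_scale[of 0 0] by simp

lemma B_commute: "B u v = B v u"
  by (simp add: polar_def algebra_simps)

lemma B_add_left [simp]: "B (u + w) v = B u v + B w v"
  and B_scale_left [simp]: "B (c *s u) v = c * B u v"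
  using quadratic by (simp_all add: is_quadratic_form_def)

lemma B_add_right [simp]: "B v (u + w) = B v u + B v w"
  and B_scale_right [simp]: "B v (c *s u) = c * B v u"
  by (simp_all add: B_commute[of v])

lemma B_0_left [simp]: "B 0 v = 0" and B_0_right [simp]: "B v 0 = 0"
  using B_scale_left[of 0 0 v] B_scale_right[of v 0 0] by simp_all

lemma B_self [simp]: "B v v = 0"
  by (simp add: polar_def)

lemma f_add: "f (u + v) = f u + f v + B u v"
  by (simp add: polar_def algebra_simps)

section \<open>Orthogonal complements and their dimensions\<close>

lemma subspace_perp: "vec.subspace (perp f A)"
  by (auto simp: vec.subspace_def perp_def)

lemma perp_span [simp]: "perp f (vec.span A) = perp f A"
proof
  show "perp f (vec.span A) \<subseteq> perp f A"
    by (auto simp: perp_def vec.span_base)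
  show "perp f A \<subseteq> perp f (vec.span A)"
  proof
    fix v assume v: "v \<in> perp f A"
    have "B u v = 0" if "u \<in> vec.span A" for u
      using that by (induction rule: vec.span_induct_alt) (use v in \<open>auto simp: perp_def\<close>)
    then show "v \<in> perp f (vec.span A)" by (simp add: perp_def)
  qed
qed

lemma perp_UNIV: "perp f UNIV = {0}"
  using nondegenerate by (auto simp: perp_def B_commute)

text \<open>The intersection is the kernel of the linear form \<open>B a\<close> on
  \<open>U\<close>; any vector of \<open>U\<close> outside this kernel spans \<open>U\<close>
  together with it.\<close>

lemma dim_inter_perp_singleton:
  assumes U: "vec.subspace U"
  shows "vec.dim U \<le> vec.dim (U \<inter> perp f {a}) + 1"
proof (cases "U \<subseteq> perp f {a}")
  case True
  then show ?thesis by (simp add: Int_absorb2)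
next
  case False
  then obtain w where w: "w \<in> U" "B a w \<noteq> 0" by (auto simp: perp_def)
  have "U \<subseteq> vec.span (insert w (U \<inter> perp f {a}))"
  proof
    fix v assume v: "v \<in> U"
    let ?k = "B a v / B a w"
    have "v - ?k *s w \<in> U \<inter> perp f {a}"
      using v w U by (auto simp: perp_def vec.subspace_add vec.subspace_scale)
    then show "v \<in> vec.span (insert w (U \<inter> perp f {a}))"
      unfolding vec.span_breakdown_eq by (meson vec.span_base)
  qed
  then have "vec.dim U \<le> vec.dim (insert w (U \<inter> perp f {a}))"
    by (rule vec.dim_mono)
  then show ?thesis by (auto simp: vec.dim_insert split: if_splits)
qed

lemma dim_inter_perp:
  assumes "finite A" "vec.subspace U"
  shows "vec.dim U \<le> vec.dim (U \<inter> perp f A) + card A"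
  using assms(1)
proof (induction rule: finite_induct)
  case empty
  then show ?case by (simp add: perp_def)
next
  case (insert a A)
  have "U \<inter> perp f (insert a A) = (U \<inter> perp f A) \<inter> perp f {a}"
    by (auto simp: perp_def)
  then show ?case
    using insert dim_inter_perp_singleton[of "U \<inter> perp f A" a]
      vec.subspace_inter[OF assms(2) subspace_perp[of A]] by simp
qed

text \<open>A basis of \<open>W\<close> imposes \<open>vec.dim W\<close> linear conditions, which
  bounds the complement from below. The vectors that extend it to a basis of the whole space cut
  \<open>perp f W\<close> down to the radical of \<open>B\<close>, which is zero; this bounds it
  from above.\<close>

lemma dim_perp: "vec.dim (perp f W) + vec.dim W = 6"
proof -
  have dimU: "vec.dim (UNIV :: ('a^6) set) = 6" unfolding vec_dim_card by simp
  obtain b where b: "b \<subseteq> W" "vec.independent b" "W \<subseteq> vec.span b" "card b = vec.dim W"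
    by (rule vec.basis_exists)
  have finb: "finite b" by (rule vec.finiteI_independent[OF b(2)])
  have span_b: "vec.span b = vec.span W"
    by (meson b(1,3) subset_antisym vec.span_mono vec.span_minimal vec.subspace_span)
  have perp_b: "perp f b = perp f W"
    using perp_span[of b] perp_span[of W] by (simp add: span_b)
  have "6 \<le> vec.dim (perp f W) + vec.dim W"
    using dim_inter_perp[OF finb vec.subspace_UNIV] perp_b b(4) dimU by simp
  moreover
  let ?b = "vec.extend_basis b"
  have "vec.dim (perp f b) \<le> vec.dim (perp f b \<inter> perp f (?b - b)) + card (?b - b)"
    by (rule dim_inter_perp) (auto simp: subspace_perp vec.finiteI_independent vec.independent_extend_basis b(2))
  moreover have "perp f b \<inter> perp f (?b - b) = perp f ?b"
    using vec.extend_basis_superset[OF b(2)] by (auto simp: perp_def)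
  moreover have "perp f ?b = {0}"
    using perp_span[of ?b] perp_UNIV by (simp add: b(2))
  moreover have "card ?b = 6"
    using vec.dim_eq_card_independent[OF vec.independent_extend_basis[OF b(2)]]
      vec.dim_span[of ?b] dimU by (simp add: b(2))
  moreover have "card (?b - b) = card ?b - card b"
    using vec.extend_basis_superset[OF b(2)] finb by (simp add: card_Diff_subset)
  moreover have "vec.dim W \<le> 6"
    using vec.dim_subset[of W UNIV] dimU by simp
  ultimately show ?thesis using perp_b b(4) by simp
qed

text \<open>One inclusion is the symmetry of \<open>B\<close>; equality follows by counting
  dimensions with \<open>dim_perp\<close> twice.\<close>

lemma perp_perp: "perp f (perp f A) = vec.span A"
proof -
  have "vec.span A \<subseteq> perp f (perp f A)"
    by (intro vec.span_minimal subspace_perp) (auto simp: perp_def B_commute)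
  moreover have "vec.dim (perp f (perp f A)) \<le> vec.dim (vec.span A)"
    using dim_perp[of A] dim_perp[of "perp f A"] by simp
  ultimately show ?thesis
    using vec.subspace_dim_equal[OF vec.subspace_span subspace_perp] by blast
qed

section \<open>Singular vectors and totally singular subspaces\<close>

lemma totally_singular_span:
  assumes f: "\<And>a. a \<in> A \<Longrightarrow> f a = 0"
    and B: "\<And>a b. a \<in> A \<Longrightarrow> b \<in> A \<Longrightarrow> B a b = 0"
  shows "totally_singular f (vec.span A)"
proof -
  \<comment> \<open>Orthogonality to the generators is carried through the induction, since adding a
    multiple of \<open>a\<close> to \<open>v\<close> brings in \<open>B a v\<close>.\<close>
  have "f v = 0 \<and> (\<forall>a\<in>A. B a v = 0)" if "v \<in> vec.span A" for v
    using that by (induction rule: vec.span_induct_alt) (auto simp: f_add f B)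
  then show ?thesis by (simp add: totally_singular_def)
qed

lemma totally_singular_orthogonal:
  assumes "totally_singular f U" "u \<in> U" "v \<in> U"
  shows "B u v = 0"
proof -
  have "f (u + v) = 0" "f u = 0" "f v = 0"
    using assms by (auto simp: totally_singular_def vec.subspace_add)
  then show ?thesis by (simp add: f_add)
qed

text \<open>On an orthogonal pair the form is \<open>a^2 * f u + b^2 * f v\<close>. Every scalar is
  a square, so this is the square of a linear form in \<open>a\<close> and \<open>b\<close> and has
  a nontrivial zero.\<close>

lemma singular_vector_in_isotropic_plane:
  assumes "u \<noteq> 0" "v \<notin> vec.span {u}" "B u v = 0"
  obtains a b where "a *s u + b *s v \<noteq> 0" "f (a *s u + b *s v) = 0"
proof (cases "f u = 0")
  case True
  then show thesis using that[of 1 0] assms by simp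
next
  case False
  obtain c where c: "c\<^sup>2 = f v / f u" by (rule obtain_sqrt)
  have "f (c *s u + 1 *s v) = 0" using c False assms(3) by (simp add: f_add)
  moreover have "c *s u + 1 *s v \<noteq> 0"
  proof
    assume "c *s u + 1 *s v = 0"
    then have "v = c *s u" by simp
    then show False using assms(2) vec.span_singleton[of u] by blast
  qed
  ultimately show thesis using that by blast
qed

lemma exists_notin_span:
  assumes "vec.dim A < vec.dim W"
  obtains v where "v \<in> W" "v \<notin> vec.span A"
proof -
  have "\<not> W \<subseteq> vec.span A"
    using assms vec.dim_mono[of W A] by linarith
  then show thesis using that by blast
qed

text \<open>The vectors of \<open>W\<close> orthogonal to a given \<open>u\<close> have dimension at
  least 2, so some \<open>v\<close> among them is independent of \<open>u\<close>; the orthogonal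
  pair \<open>u\<close>, \<open>v\<close> then yields a singular vector.\<close>

lemma exists_singular_vector:
  assumes W: "vec.subspace W" and dim: "vec.dim W \<ge> 3"
  obtains s where "s \<in> W" "s \<noteq> 0" "f s = 0"
proof -
  obtain u where u: "u \<in> W" "u \<noteq> 0"
    using exists_notin_span[of "{}" W] dim by auto
  have "vec.dim {u} < vec.dim (W \<inter> perp f {u})"
    using dim_inter_perp_singleton[OF W, of u] dim u by simp
  then obtain v where v: "v \<in> W \<inter> perp f {u}" "v \<notin> vec.span {u}"
    by (rule exists_notin_span)
  have "B u v = 0" using v(1) by (simp add: perp_def)
  with u(2) v(2) obtain a b where "a *s u + b *s v \<noteq> 0" "f (a *s u + b *s v) = 0"
    by (rule singular_vector_in_isotropic_plane)
  moreover have "a *s u + b *s v \<in> W"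
    using W u v by (simp add: vec.subspace_add vec.subspace_scale)
  ultimately show thesis using that by blast
qed

text \<open>Otherwise \<open>x\<close>, \<open>y\<close> and \<open>z\<close> would span a totally
  singular subspace of dimension 3.\<close>

lemma singular_orthogonal_in_span:
  assumes two: "\<And>U. totally_singular f U \<Longrightarrow> vec.dim U \<le> 2"
    and x: "x \<noteq> 0" "f x = 0" and y: "y \<notin> vec.span {x}" "f y = 0" "B x y = 0"
    and z: "f z = 0" "B x z = 0" "B y z = 0"
  shows "z \<in> vec.span {x, y}"
proof (rule ccontr)
  assume z3: "z \<notin> vec.span {x, y}"
  have "totally_singular f (vec.span {z, y, x})"
    by (rule totally_singular_span) (use x y z in \<open>auto simp: B_commute\<close>)
  then have "vec.dim {z, y, x} \<le> 2" using two vec.dim_span by metis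
  moreover have "z \<notin> vec.span {y, x}" using z3 insert_commute[of x y "{}"] by metis
  then have "vec.dim {z, y, x} = 3"
    using x y by (simp add: vec.dim_insert)
  ultimately show False by simp
qed

text \<open>The complement of \<open>H0\<close> is spanned by one vector \<open>u\<close>. As
  \<open>B\<close> is alternating, \<open>u\<close> lies in \<open>H0\<close> and is orthogonal to
  it, so nondegeneracy on \<open>H0\<close> forces \<open>f u\<close> to be nonzero; a square root
  of its inverse scales \<open>u\<close> to value 1.\<close>

lemma hyperplane_nucleus:
  assumes H0: "vec.subspace H0" "vec.dim H0 = 5" and par: "nondeg_on f H0"
  obtains n0 where "f n0 = 1" "H0 = {v. B n0 v = 0}"
proof -
  have dim1: "vec.dim (perp f H0) = 1" using dim_perp[of H0] H0(2) by simp
  then have "\<not> perp f H0 \<subseteq> {0}" using vec.dim_eq_0[of "perp f H0"] by simp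
  then obtain u where u: "u \<in> perp f H0" "u \<noteq> 0" by blast
  have "H0 \<subseteq> perp f {u}" using u by (auto simp: perp_def B_commute)
  moreover have "vec.dim (perp f {u}) = 5" using dim_perp[of "{u}"] u by simp
  ultimately have H0_eq: "H0 = perp f {u}"
    using H0 subspace_perp by (intro vec.subspace_dim_equal) auto
  then have "u \<in> H0" by (simp add: perp_def)
  then have fu: "f u \<noteq> 0"
    using par u unfolding nondeg_on_def perp_def by (auto simp: B_commute)
  obtain r where r: "r\<^sup>2 = inverse (f u)" by (rule obtain_sqrt)
  then have "r \<noteq> 0" using fu by auto
  show thesis
    by (rule that[of "r *s u"]) (use r fu \<open>r \<noteq> 0\<close> in \<open>auto simp: H0_eq perp_def\<close>)
qed

end

section \<open>Points outside the hyperplane and their ovoids\<close>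

abbreviation pt :: "'a::field ^ 6 \<Rightarrow> 'a ppoint" where
  "pt v \<equiv> vec.span {v}"

lemma pt_subset_iff: "vec.subspace W \<Longrightarrow> pt v \<subseteq> W \<longleftrightarrow> v \<in> W"
  by (meson empty_subsetI insert_subset subset_trans vec.span_minimal vec.span_superset)

lemma pg_points_eq: "pg_points = pt ` (- {0})"
proof
  show "pt ` (- {0}) \<subseteq> pg_points"
    by (auto simp: pg_points_def)
  show "pg_points \<subseteq> pt ` (- {0})"
  proof
    fix W assume "W \<in> pg_points"
    then have W: "vec.subspace W" "vec.dim W = 1" by (auto simp: pg_points_def)
    then have "\<not> W \<subseteq> {0}" using vec.dim_eq_0[of W] by simp
    then obtain v where v: "v \<in> W" "v \<noteq> 0" by blast
    then have "pt v = W"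
      using W by (intro vec.subspace_dim_equal) (auto simp: pt_subset_iff)
    then show "W \<in> pt ` (- {0})" using v by blast
  qed
qed

lemma pt_in_pg_points_iff: "pt v \<in> pg_points \<longleftrightarrow> v \<noteq> 0"
  by (auto simp: pg_points_def)

lemma pg_point_cases:
  assumes "p \<in> pg_points"
  obtains v where "v \<noteq> 0" "p = pt v"
  using assms pg_points_eq by blast

lemma pt_in_pts_in_iff:
  "vec.subspace W \<Longrightarrow> pt v \<in> pts_in W \<longleftrightarrow> v \<noteq> 0 \<and> v \<in> W"
  by (simp add: pts_in_def pt_in_pg_points_iff pt_subset_iff)

text \<open>Reduces an equality of point sets to a computation with spanning vectors.\<close>

lemma point_set_eqI:
  assumes "X \<subseteq> range pt" "Y \<subseteq> range pt" "\<And>z. pt z \<in> X \<longleftrightarrow> pt z \<in> Y"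
  shows "X = Y"
proof -
  have "p \<in> X \<longleftrightarrow> p \<in> Y" if "p \<in> range pt" for p
    using that assms(3) by (elim imageE) simp
  then show ?thesis using assms(1,2) by blast
qed

lemma pt_scale: "c \<noteq> 0 \<Longrightarrow> pt (c *s v) = pt v"
  using vec.span_image_scale[of "{v}" "\<lambda>_. c"] by simp

lemma pt_eq_iff:
  assumes "v \<noteq> 0"
  shows "pt v = pt w \<longleftrightarrow> (\<exists>c. c \<noteq> 0 \<and> v = c *s w)"
proof
  assume "pt v = pt w"
  then have "v \<in> pt w" using vec.span_base[of v "{v}"] by simp
  then obtain c where "v = c *s w" by (auto simp: vec.span_singleton)
  then show "\<exists>c. c \<noteq> 0 \<and> v = c *s w" using assms by (metis vec.scale_zero_left)
qed (use pt_scale in blast)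

text \<open>The hyperplane enters through its nucleus: \<open>hyperplane_nucleus\<close> supplies
  the normalised vector \<open>n0\<close>.\<close>

locale elliptic_hyperplane = char2_quadratic_form T f
  for T :: "'a::{field,finite} itself" and f :: "'a ^ 6 \<Rightarrow> 'a" +
  fixes H0 :: "('a ^ 6) set" and n0 :: "'a ^ 6"
  assumes witt_2: "witt_index_on f UNIV 2"
    and H0_eq: "H0 = {v. B n0 v = 0}"
    and f_n0 [simp]: "f n0 = 1"
begin

text \<open>Scaling to \<open>B n0 x = 1\<close> identifies the affine points with the vectors in \<open>A\<close>.\<close>

definition A :: "('a ^ 6) set" where
  "A = {x. f x = 0 \<and> B n0 x = 1}"

text \<open>The spanning vectors of the points of \<open>Q0\<close>. In contrast to
  \<open>A\<close>, no scaling is singled out, because \<open>B n0\<close> vanishes on them.\<close>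

definition Z :: "('a ^ 6) set" where
  "Z = {z. z \<noteq> 0 \<and> f z = 0 \<and> B n0 z = 0}"

abbreviation ovoid_of :: "'a ^ 6 \<Rightarrow> 'a ppoint set" where
  "ovoid_of x \<equiv> phi0_pt f H0 (pt x)"

text \<open>The projective line through \<open>pt x\<close> and \<open>pt p\<close> without
  \<open>pt p\<close>, its point at infinity.\<close>

definition aff_line :: "'a ^ 6 \<Rightarrow> 'a ^ 6 \<Rightarrow> 'a ppoint set" where
  "aff_line x p = range (\<lambda>t. pt (x + t *s p))"

lemma subspace_H0: "vec.subspace H0"
  by (auto simp: H0_eq vec.subspace_def)

lemma n0_nonzero [simp]: "n0 \<noteq> 0"
  using f_n0 by (metis f_0 zero_neq_one)

lemma A_nonzero: "x \<in> A \<Longrightarrow> x \<noteq> 0"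
  by (auto simp: A_def)

lemma totally_singular_dim_le: "totally_singular f U \<Longrightarrow> vec.dim U \<le> 2"
  using witt_2 by (simp add: witt_index_on_def)

lemma pt_in_quadric_iff: "pt v \<in> quadric f \<longleftrightarrow> v \<noteq> 0 \<and> f v = 0"
proof -
  have "(\<forall>w\<in>pt v. f w = 0) \<longleftrightarrow> f v = 0"
    by (auto simp: vec.span_singleton dest: spec[of _ 1])
  then show ?thesis by (simp add: quadric_def pt_in_pg_points_iff)
qed

lemma pt_in_Q0_iff: "pt v \<in> Q0 f H0 \<longleftrightarrow> v \<in> Z"
  using pt_in_pts_in_iff[OF subspace_H0, of v]
  by (auto simp: Q0_def Z_def pt_in_quadric_iff H0_eq)

lemma Q0_eq: "Q0 f H0 = pt ` Z"
proof -
  have "Q0 f H0 \<subseteq> range pt"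
    by (auto simp: Q0_def pts_in_def elim!: pg_point_cases)
  then show ?thesis
    by (rule point_set_eqI) (auto simp: pt_in_Q0_iff, use pt_in_Q0_iff in metis)
qed

lemma pt_A_inj:
  assumes "x \<in> A" "y \<in> A" "pt x = pt y"
  shows "x = y"
proof -
  obtain c where "x = c *s y"
    using assms pt_eq_iff A_nonzero by blast
  then show ?thesis using assms by (auto simp: A_def)
qed

lemma aff_points_eq: "aff_points f H0 = pt ` A"
proof
  show "pt ` A \<subseteq> aff_points f H0"
    by (auto simp: aff_points_def pt_in_quadric_iff pt_in_Q0_iff A_nonzero) (auto simp: A_def Z_def)
  show "aff_points f H0 \<subseteq> pt ` A"
  proof
    fix p assume p: "p \<in> aff_points f H0"
    then obtain v where v: "p = pt v"
      by (auto simp: aff_points_def quadric_def elim: pg_point_cases)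
    then have "f v = 0" "B n0 v \<noteq> 0"
      using p by (auto simp: aff_points_def pt_in_quadric_iff pt_in_Q0_iff Z_def)
    then have "inverse (B n0 v) *s v \<in> A" "pt (inverse (B n0 v) *s v) = p"
      using v by (auto simp: A_def pt_scale)
    then show "p \<in> pt ` A" by blast
  qed
qed

section \<open>Ovoids cut out by affine points\<close>

lemma ovoid_of_subset: "ovoid_of x \<subseteq> pt ` Z"
  by (auto simp: phi0_pt_def Q0_eq)

lemma pt_in_ovoid_of_iff: "pt z \<in> ovoid_of x \<longleftrightarrow> z \<in> Z \<and> B x z = 0"
proof -
  have "pt z \<in> pts_in (perp f {x}) \<longleftrightarrow> z \<noteq> 0 \<and> B x z = 0"
    by (simp add: pt_in_pts_in_iff[OF subspace_perp]) (simp add: perp_def)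
  then show ?thesis by (auto simp: phi0_pt_def pt_in_Q0_iff Z_def)
qed

text \<open>\<open>f (x + n0) = f x + f n0 + B x n0 = 0 + 1 + 1\<close>, and
  \<open>B n0 n0 = 0\<close>.\<close>

lemma add_n0_in_A: "x \<in> A \<Longrightarrow> x + n0 \<in> A"
  by (auto simp: A_def f_add B_commute)

lemma perp_lift_n0: "perp f {x, n0} = {v. B x v = 0 \<and> B n0 v = 0}"
  by (auto simp: perp_def)

lemma span_lift_n0: "vec.span {x, n0} = {a *s x + b *s n0 | a b. True}"
proof -
  have "v + w = u \<longleftrightarrow> v = w + u" for u v w :: "'a ^ 6"
    using vec_add_eq_iff[of v w u] by (simp add: add.commute)
  then show ?thesis
    by (auto simp: vec.span_insert vec.span_singleton image_iff)
qed

text \<open>\<open>Q0\<close> is orthogonal to \<open>n0\<close>, so the hyperplane orthogonal to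
  \<open>x\<close> may be replaced by a solid inside \<open>H0\<close>, as the definition of an
  elliptic ovoid demands.\<close>

lemma ovoid_of_eq_solid: "ovoid_of x = pts_in (perp f {x, n0}) \<inter> Q0 f H0"
proof (rule point_set_eqI)
  show "ovoid_of x \<subseteq> range pt" using ovoid_of_subset by blast
  show "pts_in (perp f {x, n0}) \<inter> Q0 f H0 \<subseteq> range pt" using Q0_eq by blast
  fix z
  have "pt z \<in> pts_in (perp f {x, n0}) \<longleftrightarrow> z \<noteq> 0 \<and> B x z = 0 \<and> B n0 z = 0"
    unfolding pt_in_pts_in_iff[OF subspace_perp] by (simp add: perp_lift_n0)
  then show "pt z \<in> ovoid_of x \<longleftrightarrow> pt z \<in> pts_in (perp f {x, n0}) \<inter> Q0 f H0"
    by (auto simp: pt_in_ovoid_of_iff pt_in_Q0_iff Z_def)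
qed

lemma perp_perp_lift_n0:
  assumes "\<forall>v\<in>perp f {x, n0}. B y v = 0"
  obtains a b where "y = a *s x + b *s n0"
proof -
  have "y \<in> perp f (perp f {x, n0})"
    using assms by (auto simp: perp_def B_commute)
  then show thesis using that by (auto simp: perp_perp span_lift_n0)
qed

lemma dim_perp_lift_n0:
  assumes "x \<in> A"
  shows "vec.dim (perp f {x, n0}) = 4"
proof -
  have "x \<notin> pt n0" using assms by (auto simp: A_def vec.span_singleton)
  then have "vec.dim {x, n0} = 2" by (simp add: vec.dim_insert)
  then show ?thesis using dim_perp[of "{x, n0}"] by simp
qed

text \<open>After scaling \<open>u\<close> to \<open>w\<close> with \<open>B s w = 1\<close>, the
  vector \<open>w + f w *s s\<close> has value \<open>f w + f w * B w s = 0\<close>.\<close>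

lemma hyperbolic_partner:
  assumes S: "vec.subspace S" and s: "f s = 0" "u \<in> S" "s \<in> S" "B s u \<noteq> 0"
  obtains u' where "u' \<in> S" "f u' = 0" "B s u' = 1"
proof -
  define w where "w = inverse (B s u) *s u"
  have w: "w \<in> S" "B s w = 1" using assms by (auto simp: w_def vec.subspace_scale)
  have "w + f w *s s \<in> S" "f (w + f w *s s) = 0" "B s (w + f w *s s) = 1"
    using w s S by (auto simp: f_add vec.subspace_add vec.subspace_scale B_commute[of w])
  then show thesis by (rule that)
qed

text \<open>The solid orthogonal to \<open>x\<close> and \<open>n0\<close> meets their span only in
  0, so it has no radical. A totally singular subspace of it can be enlarged by \<open>x\<close>, so
  Witt index 2 of the whole space leaves at most 1 for the solid.\<close>

lemma ovoid_of_in_elliptic_ovoids: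
  assumes x: "x \<in> A"
  shows "ovoid_of x \<in> elliptic_ovoids f H0"
proof -
  let ?S = "perp f {x, n0}"
  have sub: "vec.subspace ?S" by (rule subspace_perp)
  have SH: "?S \<subseteq> H0" by (auto simp: perp_lift_n0 H0_eq)
  have "nondeg_on f ?S"
    unfolding nondeg_on_def
  proof (intro notI, elim bexE conjE)
    fix w assume w: "w \<in> ?S" "w \<noteq> 0" "f w = 0" "\<forall>u\<in>?S. B w u = 0"
    then obtain a b where "w = a *s x + b *s n0"
      using perp_perp_lift_n0[of x w] by blast
    \<comment> \<open>\<open>B n0 w = 0\<close> gives \<open>a = 0\<close>, and
      \<open>B x w = 0\<close> gives \<open>b = 0\<close>.\<close>
    then show False using w x by (auto simp: perp_lift_n0 A_def B_commute[of x])
  qed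
  moreover have "witt_index_on f ?S 1"
    unfolding witt_index_on_def
  proof (intro conjI allI impI)
    obtain s where s: "s \<in> ?S" "s \<noteq> 0" "f s = 0"
      using exists_singular_vector[OF sub] dim_perp_lift_n0[OF x] by auto
    have "totally_singular f (pt s)" by (rule totally_singular_span) (use s in auto)
    moreover have "pt s \<subseteq> ?S" using s by (simp add: pt_subset_iff sub)
    ultimately show "\<exists>U. U \<subseteq> ?S \<and> totally_singular f U \<and> vec.dim U = 1"
      using s by (intro exI[of _ "pt s"]) auto
  next
    fix U assume U: "U \<subseteq> ?S \<and> totally_singular f U"
    have "totally_singular f (vec.span (insert x U))"
    proof (rule totally_singular_span)
      fix a b assume ab: "a \<in> insert x U" "b \<in> insert x U"
      show "f a = 0" using ab U x by (auto simp: A_def totally_singular_def)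
      have "B x u = 0" if "u \<in> U" for u using that U by (auto simp: perp_lift_n0)
      then show "B a b = 0"
        using ab U totally_singular_orthogonal[of U a b] by (auto simp: B_commute[of _ x])
    qed
    then have "vec.dim (insert x U) \<le> 2"
      using totally_singular_dim_le vec.dim_span by metis
    moreover have "x \<notin> vec.span U"
    proof
      assume "x \<in> vec.span U"
      then have "x \<in> ?S" using U sub vec.span_minimal by blast
      then show False using x by (simp add: perp_lift_n0 A_def)
    qed
    ultimately show "vec.dim U \<le> 1" by (simp add: vec.dim_insert)
  qed
  ultimately show ?thesis
    using sub SH ovoid_of_eq_solid[of x] dim_perp_lift_n0[OF x] by (auto simp: elliptic_ovoids_def)
qed

text \<open>Adding \<open>n0\<close> changes nothing because \<open>n0\<close> is orthogonal to
  \<open>Z\<close>. Conversely, the singular vectors of the solid span it, so \<open>y\<close> is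
  orthogonal to the whole solid and lies in the span of \<open>x\<close> and
  \<open>n0\<close>.\<close>

lemma ovoid_of_eq_iff:
  assumes x: "x \<in> A" and y: "y \<in> A"
  shows "ovoid_of x = ovoid_of y \<longleftrightarrow> y = x \<or> y = x + n0"
proof
  assume "y = x \<or> y = x + n0"
  moreover have "ovoid_of x = ovoid_of (x + n0)"
  proof -
    have "pt z \<in> ovoid_of x \<longleftrightarrow> pt z \<in> ovoid_of (x + n0)" for z
      by (auto simp: pt_in_ovoid_of_iff Z_def)
    then show ?thesis
      using ovoid_of_subset by (intro point_set_eqI) (blast+)
  qed
  ultimately show "ovoid_of x = ovoid_of y" by blast
next
  assume eq: "ovoid_of x = ovoid_of y"
  let ?S = "perp f {x, n0}"
  have sub: "vec.subspace ?S" by (rule subspace_perp)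
  have sing: "B y v = 0" if "v \<in> ?S" "f v = 0" for v
  proof (cases "v = 0")
    case False
    then have "pt v \<in> ovoid_of x" using that by (simp add: pt_in_ovoid_of_iff Z_def perp_lift_n0)
    then show ?thesis using eq pt_in_ovoid_of_iff by blast
  qed simp
  obtain s where s: "s \<in> ?S" "s \<noteq> 0" "f s = 0"
    using exists_singular_vector[OF sub] dim_perp_lift_n0[OF x] by auto
  have "\<exists>u\<in>?S. B s u \<noteq> 0"
  proof (rule ccontr)
    assume "\<not> ?thesis"
    then obtain a b where "s = a *s x + b *s n0"
      using perp_perp_lift_n0[of x s] by blast
    then show False using s x by (auto simp: perp_lift_n0 A_def B_commute[of x])
  qed
  then obtain u where u: "u \<in> ?S" "f u = 0" "B s u = 1"
    using hyperbolic_partner[OF sub s(3) _ s(1)] by blast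
  have "B y v = 0" if v: "v \<in> ?S" for v
  proof -
    \<comment> \<open>The component of \<open>v\<close> orthogonal to the hyperbolic pair
      \<open>s\<close>, \<open>u\<close>.\<close>
    define m where "m = v + B v u *s s + B v s *s u"
    have m: "m \<in> ?S" "B m s = 0" "B m u = 0"
      using v s u sub by (auto simp: m_def vec.subspace_add vec.subspace_scale B_commute[of u])
    \<comment> \<open>The vector \<open>f m *s s + u\<close> is orthogonal to \<open>m\<close> and
      has the same value \<open>f m\<close>, so the sum is singular; this expresses \<open>m\<close>
      through singular vectors.\<close>
    have "f (m + (f m *s s + u)) = 0"
      using m s u unfolding f_add[of m] by (simp add: f_add)
    then have "B y (m + (f m *s s + u)) = 0"
      by (intro sing) (use m s u sub in \<open>auto simp: vec.subspace_add vec.subspace_scale\<close>)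
    moreover have "B y s = 0" "B y u = 0" using sing s u by auto
    ultimately have "B y m = 0" by simp
    then show ?thesis using \<open>B y s = 0\<close> \<open>B y u = 0\<close> by (simp add: m_def)
  qed
  then obtain a b where ab: "y = a *s x + b *s n0"
    using perp_perp_lift_n0[of x y] by blast
  \<comment> \<open>Comparing \<open>B n0\<close> on both sides gives \<open>a = 1\<close>; then
    \<open>f y = b^2 + b\<close> must vanish.\<close>
  then have "a = 1" using x y by (simp add: A_def)
  then have "b * (b + 1) = 0"
    using ab x y by (simp add: A_def f_add B_commute[of x] power2_eq_square algebra_simps)
  then have "b = 0 \<or> b = 1" by auto
  then show "y = x \<or> y = x + n0" using ab \<open>a = 1\<close> by auto
qed

text \<open>This is the normal form \<open>a^2 + a * b + b^2 * f d\<close> of an anisotropic plane.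
  \<open>B c v\<close> cannot vanish for independent \<open>c\<close>, \<open>v\<close>, since an
  orthogonal pair spans a singular vector.\<close>

lemma anisotropic_plane_basis:
  assumes M: "vec.subspace M" and dim: "vec.dim M \<ge> 2"
    and aniso: "\<And>m. m \<in> M \<Longrightarrow> f m = 0 \<Longrightarrow> m = 0"
  obtains c d where "c \<in> M" "d \<in> M" "f c = 1" "B c d = 1"
proof -
  obtain u where u: "u \<in> M" "u \<noteq> 0"
    using exists_notin_span[of "{}" M] dim by auto
  then have fu: "f u \<noteq> 0" using aniso by blast
  obtain r where r: "r\<^sup>2 = inverse (f u)" by (rule obtain_sqrt)
  define c where "c = r *s u"
  have c: "c \<in> M" "f c = 1"
    using u M r fu by (auto simp: c_def vec.subspace_scale)
  then have c0: "c \<noteq> 0" by auto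
  obtain v where v: "v \<in> M" "v \<notin> pt c"
    using exists_notin_span[of "{c}" M] dim c0 by auto
  have cv: "B c v \<noteq> 0"
  proof
    assume "B c v = 0"
    with c0 v(2) obtain a b where "a *s c + b *s v \<noteq> 0" "f (a *s c + b *s v) = 0"
      by (rule singular_vector_in_isotropic_plane)
    moreover have "a *s c + b *s v \<in> M"
      using c v M by (simp add: vec.subspace_add vec.subspace_scale)
    ultimately show False using aniso by blast
  qed
  show thesis
    by (rule that[of c "inverse (B c v) *s v"]) (use c v cv M in \<open>auto simp: vec.subspace_scale\<close>)
qed

text \<open>If \<open>S\<^sup>\<perp>\<close> contained no singular point, then \<open>V\<close> would have two orthogonal anisotropic
  planes; since the Artin-Schreier map has index 2 their sum contains a totally singular plane,
  which together with a singular vector of \<open>S\<close> gives Witt index 3.\<close>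

lemma elliptic_ovoid_eq_ovoid_of:
  assumes X: "X \<in> elliptic_ovoids f H0"
  obtains x where "x \<in> A" "X = ovoid_of x"
proof -
  obtain S where S: "vec.subspace S" "S \<subseteq> H0" "vec.dim S = 4" "nondeg_on f S" "witt_index_on f S 1"
    and X_eq: "X = pts_in S \<inter> Q0 f H0"
    using X by (auto simp: elliptic_ovoids_def)
  have span_S: "vec.span S = S" using S(1) by simp
  have dimL: "vec.dim (perp f S) = 2" using dim_perp[of S] S(3) by simp
  have n0L: "n0 \<in> perp f S" using S(2) by (auto simp: perp_def H0_eq B_commute)
  have "vec.dim {n0} < vec.dim (perp f S)" using dimL by simp
  then obtain w where w: "w \<in> perp f S" "w \<notin> pt n0"
    by (rule exists_notin_span)
  have "vec.dim {w, n0} = 2" using w by (simp add: vec.dim_insert)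
  have span_L: "vec.span {w, n0} = perp f S"
  proof (rule vec.subspace_dim_equal)
    show "vec.span {w, n0} \<subseteq> perp f S"
      using w n0L subspace_perp by (intro vec.span_minimal) auto
  qed (use dimL \<open>vec.dim {w, n0} = 2\<close> subspace_perp in auto)
  \<comment> \<open>Otherwise \<open>perp f S\<close> would be totally isotropic and contain a
    singular vector; by \<open>perp_perp\<close> this vector would also lie in \<open>S\<close>,
    hence in the radical of \<open>S\<close>.\<close>
  have n0w: "B n0 w \<noteq> 0"
  proof
    assume "B n0 w = 0"
    with n0_nonzero w(2) obtain a b
      where z: "a *s n0 + b *s w \<noteq> 0" "f (a *s n0 + b *s w) = 0"
      by (rule singular_vector_in_isotropic_plane)
    let ?z = "a *s n0 + b *s w"
    have "?z \<in> perp f {w, n0}"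
      using \<open>B n0 w = 0\<close> by (simp add: perp_def B_commute[of w])
    then have "?z \<in> perp f (perp f S)" using perp_span[of "{w, n0}"] span_L by simp
    then have "?z \<in> S" by (simp only: perp_perp span_S)
    moreover have "?z \<in> perp f S"
      using w n0L subspace_perp by (simp add: vec.subspace_add vec.subspace_scale)
    ultimately show False
      using S(4) z unfolding nondeg_on_def perp_def by (auto simp: B_commute)
  qed
  define w' where "w' = inverse (B n0 w) *s w"
  have w': "w' \<in> perp f S" "B n0 w' = 1"
    using w n0w subspace_perp by (auto simp: w'_def vec.subspace_scale)
  \<comment> \<open>Since \<open>f (w' + t *s n0) = f w' + t^2 + t\<close>, a root is exactly a
    vector of \<open>A\<close> in \<open>perp f S\<close>.\<close>
  have "\<exists>t. t\<^sup>2 + t = f w'"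
  proof (rule ccontr)
    assume no_root: "\<not> ?thesis"
    have orth: "B n0 v = 0" "B w' v = 0" if "v \<in> S" for v
      using that n0L w' by (auto simp: perp_def B_commute)
    obtain s where s: "s \<in> S" "s \<noteq> 0" "f s = 0"
      using exists_singular_vector[OF S(1)] S(3) by auto
    then obtain u0 where "u0 \<in> S" "B s u0 \<noteq> 0"
      using S(4) unfolding nondeg_on_def by blast
    then obtain u where u: "u \<in> S" "f u = 0" "B s u = 1"
      using hyperbolic_partner[OF S(1) s(3) _ s(1)] by blast
    let ?M = "S \<inter> perp f {s, u}"
    have subM: "vec.subspace ?M" using S(1) subspace_perp by (rule vec.subspace_inter)
    have "card {s, u} \<le> 2" by (simp add: card_insert_if)
    then have dimM: "vec.dim ?M \<ge> 2"
      using dim_inter_perp[of "{s, u}" S] S(1,3) by simp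
    \<comment> \<open>A nonzero singular \<open>m\<close> orthogonal to \<open>s\<close> and
      \<open>u\<close> would span with \<open>s\<close> a totally singular plane inside
      \<open>S\<close>, which has Witt index 1.\<close>
    have aniso: "m = 0" if m: "m \<in> ?M" "f m = 0" for m
    proof (rule ccontr)
      assume m0: "m \<noteq> 0"
      have ts: "totally_singular f (vec.span {m, s})"
        by (rule totally_singular_span) (use m s in \<open>auto simp: perp_def B_commute\<close>)
      moreover have "vec.span {m, s} \<subseteq> S"
        using m s S(1) by (intro vec.span_minimal) auto
      ultimately have "vec.dim (vec.span {m, s}) \<le> 1"
        using S(5) unfolding witt_index_on_def by blast
      moreover have "m \<notin> pt s"
      proof
        assume "m \<in> pt s"
        then obtain k where "m = k *s s" by (auto simp: vec.span_singleton)
        moreover have "B u m = 0" using m by (simp add: perp_def)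
        ultimately show False using u(3) m0 by (auto simp: B_commute[of u])
      qed
      ultimately show False using s by (simp add: vec.dim_insert)
    qed
    obtain c d where cd: "c \<in> ?M" "d \<in> ?M" "f c = 1" "B c d = 1"
      using anisotropic_plane_basis[OF subM dimM aniso] by blast
    have d_root: "t\<^sup>2 + t \<noteq> f d" for t
    proof
      assume "t\<^sup>2 + t = f d"
      moreover have "f (d + t *s c) = f d + (t\<^sup>2 + t)"
        using cd by (simp add: f_add B_commute[of d] add.assoc)
      ultimately have "f (d + t *s c) = 0" by simp
      moreover have "d + t *s c \<in> ?M"
        using cd subM by (simp only: vec.subspace_add vec.subspace_scale)
      ultimately have "d + t *s c = 0" using aniso by blast
      then have "d = t *s c" by simp
      then show False using cd by simp
    qed
    obtain t where t: "t\<^sup>2 + t = f w' + f d"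
      using no_root d_root artin_schreier_index_2 by metis
    \<comment> \<open>By the choice of \<open>t\<close>, sending \<open>n0\<close> to
      \<open>c\<close> and \<open>w' + t *s n0\<close> to \<open>d\<close> is an isometry between
      two orthogonal planes. In characteristic 2 the sum of a vector and its image is singular, and
      \<open>z1\<close>, \<open>z2\<close> are two such sums, orthogonal to each other and to
      \<open>s\<close>.\<close>
    define z1 where "z1 = n0 + c"
    define z2 where "z2 = w' + (d + t *s n0)"
    have S_orth: "B n0 c = 0" "B w' c = 0" "B n0 d = 0" "B w' d = 0" "B n0 s = 0" "B w' s = 0"
      using orth cd s by auto
    have M_orth: "B c s = 0" "B d s = 0"
      using cd by (auto simp: perp_def B_commute)
    have w'n0: "B w' n0 = 1" using w' by (simp add: B_commute)
    have n0_perp: "B c n0 = 0" "B d n0 = 0" "B c w' = 0" "B d w' = 0"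
      using S_orth by (auto simp: B_commute)
    have fz1: "f z1 = 0" using cd S_orth by (simp add: z1_def f_add)
    have "f z2 = f w' + f d + (t\<^sup>2 + t)"
      using S_orth w'n0 n0_perp by (simp add: z2_def f_add algebra_simps)
    then have fz2: "f z2 = 0" using t by simp
    have z12: "B z1 z2 = 0"
      using S_orth w' n0_perp cd by (simp add: z1_def z2_def)
    have zs: "B z1 s = 0" "B z2 s = 0"
      using S_orth M_orth by (simp_all add: z1_def z2_def)
    \<comment> \<open>The forms \<open>B n0\<close> and \<open>B d\<close> detect that
      \<open>z1\<close>, \<open>z2\<close> and \<open>s\<close> are independent: the first separates
      \<open>z2\<close>, the second separates \<open>z1\<close> from \<open>s\<close>.\<close>
    have "B n0 z1 = 0" "B n0 z2 = 1" "B d z1 = 1" "B d s = 0"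
      using S_orth w' n0_perp cd M_orth by (simp_all add: z1_def z2_def B_commute[of d c])
    note dual = this
    have "z1 \<noteq> 0" using dual by auto
    have "z2 \<notin> pt z1" using dual by (auto simp: vec.span_singleton)
    have "s \<in> vec.span {z1, z2}"
      using singular_orthogonal_in_span[OF totally_singular_dim_le \<open>z1 \<noteq> 0\<close> fz1
          \<open>z2 \<notin> pt z1\<close> fz2 z12 s(3) zs] .
    then obtain a b where "s + a *s z1 = b *s z2"
      by (auto simp: vec.span_insert vec.span_singleton)
    then have "B n0 (s + a *s z1) = B n0 (b *s z2)" "B d (s + a *s z1) = B d (b *s z2)"
      by simp_all
    then have "b = 0" "a = 0" using dual S_orth by auto
    then show False using \<open>s + a *s z1 = b *s z2\<close> s by simp
  qed
  then obtain t where t: "t\<^sup>2 + t = f w'" by blast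
  define x where "x = w' + t *s n0"
  have x: "x \<in> A" using t w' by (simp add: A_def x_def f_add B_commute[of w'] add.assoc)
  have "S \<subseteq> perp f {x, n0}"
    using w' n0L by (auto simp: perp_lift_n0 x_def perp_def B_commute)
  then have "S = perp f {x, n0}"
    using dim_perp_lift_n0[OF x] S(1,3) subspace_perp by (intro vec.subspace_dim_equal) auto
  then have "X = ovoid_of x" using X_eq ovoid_of_eq_solid by simp
  then show thesis using x that by blast
qed

text \<open>Tangency forces \<open>p\<close> into the radical of the span of \<open>x\<close>,
  \<open>y\<close> and \<open>n0\<close>. Its coefficients are then determined up to a factor, and
  \<open>f p = 0\<close> leaves \<open>y\<close> and \<open>y + n0\<close> as candidates for the
  lift on the line joining \<open>x\<close> and \<open>p\<close>.\<close>

lemma tangent_ovoids: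
  assumes x: "x \<in> A" and y: "y \<in> A" and p: "p \<in> Z"
    and meet: "ovoid_of x \<inter> ovoid_of y = {pt p}"
  obtains y' c where "y' \<in> A" "ovoid_of y' = ovoid_of y" "y' = x + c *s p"
proof -
  have px: "B x p = 0" and py: "B y p = 0" and pn: "B n0 p = 0"
    using meet p pt_in_ovoid_of_iff by (blast, blast, simp add: Z_def)
  \<comment> \<open>Otherwise a hyperbolic partner of \<open>p\<close> in
    \<open>perp f {x, y, n0}\<close> would give a second common point of the two ovoids.\<close>
  have radical: "B p v = 0" if v: "v \<in> perp f {x, y, n0}" for v
  proof (rule ccontr)
    assume pv: "B p v \<noteq> 0"
    have subT: "vec.subspace (perp f {x, y, n0})" by (rule subspace_perp)
    have pT: "p \<in> perp f {x, y, n0}" using px py pn by (auto simp: perp_def)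
    obtain u where u: "u \<in> perp f {x, y, n0}" "f u = 0" "B p u = 1"
      using hyperbolic_partner[OF subT _ v pT pv] p by (auto simp: Z_def)
    then have "u \<in> Z" "B x u = 0" "B y u = 0" by (auto simp: Z_def perp_def)
    then have "pt u \<in> ovoid_of x \<inter> ovoid_of y" by (simp add: pt_in_ovoid_of_iff)
    then have "pt p = pt u" using meet by auto
    then obtain c where "p = c *s u" using pt_eq_iff[of p u] p by (auto simp: Z_def)
    then show False using u(3) by simp
  qed
  have "p \<in> perp f (perp f {x, y, n0})"
    using radical by (subst perp_def) (auto simp: B_commute)
  then have "p \<in> vec.span {x, y, n0}" by (simp only: perp_perp)
  then obtain a b where "p + a *s x + b *s y \<in> pt n0"
    by (auto simp: vec.span_insert add.assoc)
  then obtain c where "p + a *s x + b *s y = c *s n0" by (auto simp: vec.span_singleton)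
  then have "p = c *s n0 + (a *s x + b *s y)"
    using vec_add_eq_iff[of p] by (simp add: add.assoc)
  then have p_eq: "p = a *s x + b *s y + c *s n0" by (simp add: add.commute)
  have ab: "b = a" using pn x y by (simp add: p_eq A_def)
  have c: "c = a * B x y" using px x by (simp add: p_eq ab A_def B_commute[of x n0])
  have a0: "a \<noteq> 0" using p p_eq ab c by (auto simp: Z_def)
  let ?k = "B x y"
  \<comment> \<open>Here \<open>p = a *s (x + y + ?k *s n0)\<close>. Singularity of \<open>p\<close>
    makes \<open>?k\<close> equal to 0 or 1, so \<open>y + ?k *s n0\<close> is a lift of the ovoid
    of \<open>y\<close>, reached from \<open>x\<close> by \<open>inverse a *s p\<close>.\<close>
  have "f p = a\<^sup>2 * (?k * (?k + 1))"
    using x y unfolding p_eq ab c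
    by (simp add: f_add A_def B_commute[of _ n0] power2_eq_square algebra_simps)
  then have "?k * (?k + 1) = 0" using p a0 by (simp add: Z_def)
  then have k: "?k = 0 \<or> ?k = 1" by auto
  have "p = a *s (x + (y + ?k *s n0))"
    unfolding p_eq ab c by (simp add: vec.scale_right_distrib add.assoc)
  then have "inverse a *s p = x + (y + ?k *s n0)" using a0 by simp
  then have eq: "y + ?k *s n0 = x + inverse a *s p" by simp
  show thesis
  proof (rule that)
    show "y + ?k *s n0 \<in> A" using k y add_n0_in_A by auto
    then show "ovoid_of (y + ?k *s n0) = ovoid_of y"
      using k y ovoid_of_eq_iff by auto
    show "y + ?k *s n0 = x + inverse a *s p" by (rule eq)
  qed
qed

section \<open>Affine lines and rosettes\<close>

lemma add_scale_in_A:
  assumes "x \<in> A" "p \<in> Z" "B x p = 0"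
  shows "x + t *s p \<in> A"
  using assms by (simp add: A_def Z_def f_add)

lemma pts_in_span_pair:
  assumes x: "x \<in> A" and p: "p \<in> Z"
  shows "pts_in (vec.span {x, p}) = insert (pt p) (aff_line x p)"
proof (rule point_set_eqI)
  show "pts_in (vec.span {x, p}) \<subseteq> range pt"
    by (auto simp: pts_in_def elim!: pg_point_cases)
  show "insert (pt p) (aff_line x p) \<subseteq> range pt" by (auto simp: aff_line_def)
  fix z
  show "pt z \<in> pts_in (vec.span {x, p}) \<longleftrightarrow> pt z \<in> insert (pt p) (aff_line x p)"
  proof
    assume "pt z \<in> pts_in (vec.span {x, p})"
    then have z: "z \<noteq> 0" "z \<in> vec.span {x, p}"
      by (simp_all add: pt_in_pts_in_iff)
    then obtain a b where "z + a *s x = b *s p"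
      by (auto simp: vec.span_insert vec.span_singleton)
    then have z_eq: "z = a *s x + b *s p" using vec_add_eq_iff add.commute by metis
    show "pt z \<in> insert (pt p) (aff_line x p)"
    proof (cases "a = 0")
      case True
      then show ?thesis using z z_eq by (auto simp: pt_scale)
    next
      case False
      then have "z = a *s (x + (inverse a * b) *s p)"
        by (simp add: z_eq vec.scale_right_distrib)
      then have "pt z = pt (x + (inverse a * b) *s p)"
        using False pt_scale by blast
      then show ?thesis by (auto simp: aff_line_def)
    qed
  next
    assume "pt z \<in> insert (pt p) (aff_line x p)"
    moreover have "pt p \<in> pts_in (vec.span {x, p})"
      using p by (simp add: pt_in_pts_in_iff vec.span_base Z_def)
    moreover have "pt (x + t *s p) \<in> pts_in (vec.span {x, p})" for t
    proof -
      have "B n0 (x + t *s p) = 1" using x p by (simp add: A_def Z_def)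
      then have "x + t *s p \<noteq> 0" by (metis B_0_right zero_neq_one)
      then show ?thesis
        by (simp only: pt_in_pts_in_iff vec.subspace_span) (simp add: vec.span_add vec.span_scale vec.span_base)
    qed
    ultimately show "pt z \<in> pts_in (vec.span {x, p})" by (auto simp: aff_line_def)
  qed
qed

lemma aff_line_subset:
  assumes "x \<in> A" "p \<in> Z" "B x p = 0"
  shows "aff_line x p \<subseteq> pt ` A"
  using add_scale_in_A[OF assms] by (auto simp: aff_line_def)

lemma aff_points_Int_Q0: "pt ` A \<inter> Q0 f H0 = {}"
  unfolding aff_points_eq[symmetric] by (auto simp: aff_points_def)

lemma span_pair_line:
  assumes x: "x \<in> A" and p: "p \<in> Z" and xp: "B x p = 0"
  shows "pts_in (vec.span {x, p}) \<in> quadric_lines f"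
    and "\<not> pts_in (vec.span {x, p}) \<subseteq> Q0 f H0"
    and "pts_in (vec.span {x, p}) \<inter> Q0 f H0 = {pt p}"
    and "pts_in (vec.span {x, p}) - Q0 f H0 = aff_line x p"
proof -
  have "totally_singular f (vec.span {x, p})"
    by (rule totally_singular_span) (use x p xp in \<open>auto simp: A_def Z_def B_commute\<close>)
  moreover have "x \<notin> pt p" using x p by (auto simp: A_def Z_def vec.span_singleton)
  then have "vec.dim (vec.span {x, p}) = 2" using p by (simp add: vec.dim_insert Z_def)
  ultimately show "pts_in (vec.span {x, p}) \<in> quadric_lines f"
    by (auto simp: quadric_lines_def)
  have "pt p \<in> Q0 f H0" using p by (simp add: pt_in_Q0_iff)
  moreover have "aff_line x p \<inter> Q0 f H0 = {}"
    using aff_line_subset[OF assms] aff_points_Int_Q0 by blast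
  moreover have "pt x \<in> aff_line x p"
    unfolding aff_line_def by (rule range_eqI[of _ _ 0]) simp
  ultimately show "\<not> pts_in (vec.span {x, p}) \<subseteq> Q0 f H0"
    and "pts_in (vec.span {x, p}) \<inter> Q0 f H0 = {pt p}"
    and "pts_in (vec.span {x, p}) - Q0 f H0 = aff_line x p"
    unfolding pts_in_span_pair[OF x p] by blast+
qed

text \<open>A vector of the line outside \<open>H0\<close> is scaled to give \<open>x\<close>; the
  hyperplane cuts the plane \<open>L\<close> in dimension at least 1, which supplies
  \<open>p\<close>.\<close>

lemma quadric_line_cases:
  assumes l: "l \<in> quadric_lines f" and not_in: "\<not> l \<subseteq> Q0 f H0"
  obtains x p where "x \<in> A" "p \<in> Z" "B x p = 0" "l = pts_in (vec.span {x, p})"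
proof -
  obtain L where L: "totally_singular f L" "vec.dim L = 2" "l = pts_in L"
    using l by (auto simp: quadric_lines_def)
  have subL: "vec.subspace L" and fL: "\<And>v. v \<in> L \<Longrightarrow> f v = 0"
    using L(1) by (auto simp: totally_singular_def)
  obtain P where "P \<in> l" "P \<notin> Q0 f H0" using not_in by blast
  then obtain w where w: "w \<in> L" "w \<noteq> 0" "w \<notin> Z"
    using L(3) pt_in_Q0_iff pt_subset_iff[OF subL]
    by (auto simp: pts_in_def elim!: pg_point_cases)
  then have wn: "B n0 w \<noteq> 0" using fL by (auto simp: Z_def)
  define x where "x = inverse (B n0 w) *s w"
  have x: "x \<in> L" "x \<in> A" using w wn subL fL by (auto simp: x_def A_def vec.subspace_scale)
  \<comment> \<open>Avoiding the span of the empty set means that \<open>p\<close> is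
    nonzero.\<close>
  have "vec.dim ({} :: ('a ^ 6) set) < vec.dim (L \<inter> perp f {n0})"
    using dim_inter_perp_singleton[OF subL, of n0] L(2) by simp
  then obtain p where p: "p \<in> L \<inter> perp f {n0}" "p \<notin> vec.span {}"
    by (rule exists_notin_span)
  then have pZ: "p \<in> Z" using fL by (auto simp: Z_def perp_def B_commute)
  have xp: "B x p = 0" using totally_singular_orthogonal[OF L(1)] x p by blast
  have "x \<notin> pt p" using x pZ by (auto simp: A_def Z_def vec.span_singleton)
  then have "vec.dim {x, p} = 2" using pZ by (simp add: vec.dim_insert Z_def)
  moreover have "vec.span {x, p} \<subseteq> L" using x p subL by (intro vec.span_minimal) auto
  ultimately have "vec.span {x, p} = L"
    using subL L(2) by (intro vec.subspace_dim_equal) auto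
  then show thesis using that x pZ xp L(3) by blast
qed

lemma aff_lines_eq: "aff_lines f H0 = {aff_line x p | x p. x \<in> A \<and> p \<in> Z \<and> B x p = 0}"
proof (rule set_eqI, rule iffI)
  fix l assume "l \<in> aff_lines f H0"
  then obtain k where k: "k \<in> quadric_lines f" "\<not> k \<subseteq> Q0 f H0" "l = k - Q0 f H0"
    by (auto simp: aff_lines_def)
  obtain x p where "x \<in> A" "p \<in> Z" "B x p = 0" "k = pts_in (vec.span {x, p})"
    using quadric_line_cases[OF k(1,2)] .
  then show "l \<in> {aff_line x p | x p. x \<in> A \<and> p \<in> Z \<and> B x p = 0}"
    using k(3) span_pair_line(4) by blast
next
  fix l assume "l \<in> {aff_line x p | x p. x \<in> A \<and> p \<in> Z \<and> B x p = 0}"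
  then obtain x p where "l = aff_line x p" "x \<in> A" "p \<in> Z" "B x p = 0" by blast
  then show "l \<in> aff_lines f H0"
    using span_pair_line[of x p] unfolding aff_lines_def by blast
qed

text \<open>Translations permute the parameters, so every affine point of a line can serve as its
  base point.\<close>

lemma aff_line_shift: "aff_line (x + t *s p) p = aff_line x p"
proof -
  have "range (\<lambda>s. pt (x + t *s p + s *s p)) = (\<lambda>s. pt (x + s *s p)) ` range (\<lambda>s. t + s)"
    unfolding image_image by (simp add: vec.scale_left_distrib add.assoc)
  moreover have "range (\<lambda>s::'a. t + s) = UNIV" by (metis surj_plus)
  ultimately show ?thesis by (simp add: aff_line_def)
qed

lemma aff_line_cong:
  assumes "p \<in> Z" "pt p = pt r"
  shows "aff_line x p = aff_line x r"
proof -
  obtain c where c: "c \<noteq> 0" "p = c *s r" using assms pt_eq_iff[of p r] by (auto simp: Z_def)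
  have "range (\<lambda>t. pt (x + t *s p)) = (\<lambda>t. pt (x + t *s r)) ` range (\<lambda>t. t * c)"
    unfolding image_image by (simp add: c(2))
  moreover have "range (\<lambda>t. t * c) = UNIV"
    using c(1) by (intro surjI[where f = "\<lambda>t. t / c"]) simp
  ultimately show ?thesis by (simp add: aff_line_def)
qed

lemma pt_in_aff_line:
  assumes "y \<in> A" "x \<in> A" "p \<in> Z" "B x p = 0" "pt y \<in> aff_line x p"
  obtains t where "y = x + t *s p"
  using assms pt_A_inj add_scale_in_A unfolding aff_line_def by blast

lemma aff_line_through:
  assumes "l \<in> aff_lines f H0" "pt x \<in> l" "x \<in> A"
  obtains p where "p \<in> Z" "B x p = 0" "l = aff_line x p"
proof -
  obtain y p where y: "y \<in> A" "p \<in> Z" "B y p = 0" "l = aff_line y p"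
    using assms(1) unfolding aff_lines_eq by blast
  obtain t where t: "x = y + t *s p"
    using pt_in_aff_line[OF assms(3) y(1-3)] assms(2) y(4) by blast
  show thesis
    by (rule that[of p]) (use y t aff_line_shift in auto)
qed

text \<open>Two vectors on the line with the same ovoid are equal or differ by \<open>n0\<close>; in
  the latter case \<open>n0\<close> would be a multiple of the singular vector
  \<open>p\<close>.\<close>

lemma inj_ovoid_of_aff_line:
  assumes x: "x \<in> A" "p \<in> Z" "B x p = 0"
    and eq: "ovoid_of (x + t *s p) = ovoid_of (x + s *s p)"
  shows "t = s"
proof -
  have "x + s *s p = x + t *s p \<or> x + s *s p = x + t *s p + n0"
    using eq ovoid_of_eq_iff add_scale_in_A x by blast
  then show ?thesis
  proof
    assume "x + s *s p = x + t *s p"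
    then have "(s + t) *s p = 0" by (simp add: vec.scale_left_distrib)
    then show ?thesis using x by (simp add: Z_def)
  next
    assume "x + s *s p = x + t *s p + n0"
    then have "s *s p = t *s p + n0" by (simp add: add.assoc)
    then have "t *s p + s *s p = n0" by simp
    then have "n0 = (t + s) *s p" by (simp add: vec.scale_left_distrib)
    moreover have "f ((t + s) *s p) = 0" unfolding f_scale using x by (simp add: Z_def)
    ultimately have "f n0 = 0" by simp
    then show ?thesis by simp
  qed
qed

section \<open>Images of affine lines and lifts of rosettes\<close>

lemma phi0_line_aff_line: "phi0_line f H0 (aff_line x p) = range (\<lambda>t. ovoid_of (x + t *s p))"
  by (simp add: phi0_line_def aff_line_def image_image)

lemma rosette_at_aff_line:
  assumes x: "x \<in> A" and p: "p \<in> Z" and xp: "B x p = 0"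
  shows "rosette_at f H0 (pt p) (phi0_line f H0 (aff_line x p))"
  unfolding rosette_at_def phi0_line_aff_line
proof (intro conjI ballI impI)
  show "pt p \<in> Q0 f H0" using p by (simp add: pt_in_Q0_iff)
  show "range (\<lambda>t. ovoid_of (x + t *s p)) \<subseteq> elliptic_ovoids f H0"
    using add_scale_in_A[OF assms] ovoid_of_in_elliptic_ovoids by blast
  have "inj (\<lambda>t. ovoid_of (x + t *s p))"
    using inj_ovoid_of_aff_line[OF assms] by (rule injI)
  then show "card (range (\<lambda>t. ovoid_of (x + t *s p))) = CARD('a)"
    by (rule card_image)
  fix X Y
  assume "X \<in> range (\<lambda>t. ovoid_of (x + t *s p))" "Y \<in> range (\<lambda>t. ovoid_of (x + t *s p))" "X \<noteq> Y"
  then obtain t s where X: "X = ovoid_of (x + t *s p)" and Y: "Y = ovoid_of (x + s *s p)"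
    and ts: "t \<noteq> s" by blast
  have "pt z \<in> X \<inter> Y \<longleftrightarrow> pt z \<in> {pt p}" for z
  proof
    assume "pt z \<in> X \<inter> Y"
    then have z: "z \<in> Z" "B x z = t * B p z" "B x z = s * B p z"
      by (auto simp: X Y pt_in_ovoid_of_iff)
    \<comment> \<open>The parameters differ, so a common point is orthogonal to \<open>p\<close>,
      hence also to \<open>x\<close>. By Witt index 2 it lies on the line joining them, whose only
      point in \<open>H0\<close> is \<open>pt p\<close>.\<close>
    then have pz: "B p z = 0" using ts by auto
    have "p \<notin> pt x" using x p by (auto simp: A_def Z_def vec.span_singleton)
    then have "z \<in> vec.span {x, p}"
      using singular_orthogonal_in_span[OF totally_singular_dim_le, of x p z] x p xp z pz A_nonzero
      by (simp add: A_def Z_def)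
    then obtain a b where "z + a *s x = b *s p"
      by (auto simp: vec.span_insert vec.span_singleton)
    then have "B n0 (z + a *s x) = B n0 (b *s p)" by simp
    then have "a = 0" using x p z by (simp add: A_def Z_def)
    then have "z = b *s p" using \<open>z + a *s x = b *s p\<close> by simp
    then show "pt z \<in> {pt p}" using z by (auto simp: pt_scale Z_def)
  next
    assume "pt z \<in> {pt p}"
    moreover have "pt p \<in> X \<inter> Y" using p xp by (simp add: X Y pt_in_ovoid_of_iff)
    ultimately show "pt z \<in> X \<inter> Y" by simp
  qed
  then show "X \<inter> Y = {pt p}"
    using ovoid_of_subset X by (intro point_set_eqI) blast+
qed

lemma two_le_card_field: "2 \<le> CARD('a)"
proof -
  have "card {0, 1 :: 'a} \<le> CARD('a)" by (rule card_mono) auto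
  then show ?thesis by simp
qed

lemma rosette_other_member:
  assumes "rosette_at f H0 P R" "X \<in> R"
  obtains Y where "Y \<in> R" "Y \<noteq> X" "X \<inter> Y = {P}"
proof -
  have "\<not> R \<subseteq> {X}"
  proof
    assume "R \<subseteq> {X}"
    then have "card R \<le> 1" using card_mono[of "{X}" R] by simp
    then show False using assms(1) two_le_card_field by (simp add: rosette_at_def)
  qed
  then obtain Y where "Y \<in> R" "Y \<noteq> X" by blast
  then show thesis using that assms by (auto simp: rosette_at_def)
qed

lemma rosette_nonempty:
  assumes "rosette_at f H0 P R"
  obtains X where "X \<in> R"
proof -
  have "card R \<noteq> 0" using assms two_le_card_field by (simp add: rosette_at_def)
  then show thesis using that by fastforce
qed

text \<open>A rosette has at least two members since the field has at least two elements, and any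
  two of them meet exactly in the base point.\<close>

lemma rosette_base_unique:
  assumes P: "rosette_at f H0 P R" and P': "rosette_at f H0 P' R"
  shows "P = P'"
proof -
  obtain X where X: "X \<in> R" using rosette_nonempty[OF P] .
  obtain Y where Y: "Y \<in> R" "Y \<noteq> X" "X \<inter> Y = {P}" using rosette_other_member[OF P X] .
  have "X \<inter> Y = {P'}" using P' X Y by (auto simp: rosette_at_def)
  then show ?thesis using Y(3) by simp
qed

text \<open>Every other member is tangent to the ovoid of \<open>x\<close> at \<open>p\<close>, so
  \<open>tangent_ovoids\<close> lifts it to the line joining \<open>x\<close> and \<open>p\<close>.
  Thus \<open>R\<close> lies in the image of that line, and both sets have \<open>CARD('a)\<close>
  elements.\<close>

lemma rosette_through_ovoid_of:
  assumes R: "rosette_at f H0 P R" and x: "x \<in> A" and xR: "ovoid_of x \<in> R"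
  obtains p where "p \<in> Z" "B x p = 0" "P = pt p" "R = phi0_line f H0 (aff_line x p)"
proof -
  have "P \<in> Q0 f H0" using R by (simp add: rosette_at_def)
  then obtain p where p: "p \<in> Z" "P = pt p" using Q0_eq by blast
  obtain Y where "ovoid_of x \<inter> Y = {P}" using rosette_other_member[OF R xR] .
  then have "pt p \<in> ovoid_of x" using p by blast
  then have xp: "B x p = 0" by (simp add: pt_in_ovoid_of_iff)
  have "R \<subseteq> phi0_line f H0 (aff_line x p)"
  proof
    fix Y assume Y: "Y \<in> R"
    show "Y \<in> phi0_line f H0 (aff_line x p)"
    proof (cases "Y = ovoid_of x")
      case True
      then show ?thesis
        unfolding phi0_line_aff_line by (intro range_eqI[of _ _ 0]) simp
    next
      case False
      then have meet: "ovoid_of x \<inter> Y = {pt p}"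
        using R xR Y p by (auto simp: rosette_at_def)
      have "Y \<in> elliptic_ovoids f H0" using R Y by (auto simp: rosette_at_def)
      then obtain y where y: "y \<in> A" "Y = ovoid_of y" by (rule elliptic_ovoid_eq_ovoid_of)
      obtain y' c where y': "ovoid_of y' = ovoid_of y" "y' = x + c *s p"
        using tangent_ovoids[OF x y(1) p(1) meet[unfolded y(2)]] by metis
      have "Y = ovoid_of (x + c *s p)" using y(2) y' by simp
      then show ?thesis unfolding phi0_line_aff_line by (rule range_eqI)
    qed
  qed
  moreover have "card R = CARD('a)" using R by (simp add: rosette_at_def)
  moreover have "card (phi0_line f H0 (aff_line x p)) = CARD('a)"
    using rosette_at_aff_line[OF x p(1) xp] by (simp add: rosette_at_def)
  ultimately have "R = phi0_line f H0 (aff_line x p)"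
    by (intro card_subset_eq) (auto simp: phi0_line_aff_line)
  then show thesis using that p xp by blast
qed

text \<open>The rosette determines its base point, and a line through \<open>x\<close> is determined
  by its point at infinity.\<close>

lemma phi0_line_inj:
  assumes "x \<in> A" "p \<in> Z" "B x p = 0" "r \<in> Z" "B x r = 0"
    and eq: "phi0_line f H0 (aff_line x p) = phi0_line f H0 (aff_line x r)"
  shows "aff_line x p = aff_line x r"
proof -
  have "rosette_at f H0 (pt r) (phi0_line f H0 (aff_line x p))"
    using rosette_at_aff_line[of x r] assms by simp
  then have "pt p = pt r"
    using rosette_base_unique rosette_at_aff_line[of x p] assms by blast
  then show ?thesis using aff_line_cong assms by blast
qed

section \<open>Local bijections and fibres of size two\<close>

lemma lines_correspond:
  assumes x: "x \<in> A"
  shows "bij_betw (phi0_line f H0) {l \<in> aff_lines f H0. pt x \<in> l}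
    {m \<in> rosettes f H0. ovoid_of x \<in> m}"
proof (rule bij_betwI')
  fix l k
  assume "l \<in> {l \<in> aff_lines f H0. pt x \<in> l}" and "k \<in> {l \<in> aff_lines f H0. pt x \<in> l}"
  then obtain p r where "p \<in> Z" "B x p = 0" "l = aff_line x p"
    and "r \<in> Z" "B x r = 0" "k = aff_line x r"
    using aff_line_through x by (metis (no_types, lifting) mem_Collect_eq)
  then show "phi0_line f H0 l = phi0_line f H0 k \<longleftrightarrow> l = k"
    using phi0_line_inj x by blast
next
  fix l assume l: "l \<in> {l \<in> aff_lines f H0. pt x \<in> l}"
  then obtain p where "p \<in> Z" "B x p = 0" "l = aff_line x p"
    using aff_line_through x by blast
  then have "phi0_line f H0 l \<in> rosettes f H0"
    using rosette_at_aff_line x by (auto simp: rosettes_def)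
  then show "phi0_line f H0 l \<in> {m \<in> rosettes f H0. ovoid_of x \<in> m}"
    using l by (simp add: phi0_line_def)
next
  fix m assume "m \<in> {m \<in> rosettes f H0. ovoid_of x \<in> m}"
  then obtain P where R: "rosette_at f H0 P m" and xm: "ovoid_of x \<in> m"
    by (auto simp: rosettes_def)
  obtain p where p: "p \<in> Z" "B x p = 0" "m = phi0_line f H0 (aff_line x p)"
    using rosette_through_ovoid_of[OF R x xm] .
  have "pt x \<in> aff_line x p" unfolding aff_line_def by (rule range_eqI[of _ _ 0]) simp
  moreover have "aff_line x p \<in> aff_lines f H0" using aff_lines_eq x p by blast
  ultimately show "\<exists>l\<in>{l \<in> aff_lines f H0. pt x \<in> l}. m = phi0_line f H0 l"
    using p(3) by blast
qed

lemma points_correspond: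
  assumes l: "l \<in> aff_lines f H0"
  shows "bij_betw (phi0_pt f H0) {x \<in> aff_points f H0. x \<in> l}
    {y \<in> elliptic_ovoids f H0. y \<in> phi0_line f H0 l}"
proof -
  obtain x p where x: "x \<in> A" "p \<in> Z" "B x p = 0" "l = aff_line x p"
    using l aff_lines_eq by blast
  have "{x \<in> aff_points f H0. x \<in> l} = l"
    using aff_line_subset[OF x(1-3)] x(4) aff_points_eq by blast
  moreover have "phi0_line f H0 l \<subseteq> elliptic_ovoids f H0"
    using rosette_at_aff_line[OF x(1-3)] x(4) by (simp add: rosette_at_def)
  then have "{y \<in> elliptic_ovoids f H0. y \<in> phi0_line f H0 l} = phi0_pt f H0 ` l"
    by (auto simp: phi0_line_def)
  moreover have "inj_on (phi0_pt f H0) l"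
  proof (rule inj_onI)
    fix P P' assume "P \<in> l" "P' \<in> l" and eq: "phi0_pt f H0 P = phi0_pt f H0 P'"
    then obtain t s where "P = pt (x + t *s p)" "P' = pt (x + s *s p)"
      by (auto simp: x(4) aff_line_def)
    then show "P = P'" using inj_ovoid_of_aff_line[OF x(1-3)] eq by blast
  qed
  ultimately show ?thesis by (simp add: bij_betw_def)
qed

lemma point_fibre:
  assumes "y \<in> elliptic_ovoids f H0"
  shows "card {x \<in> aff_points f H0. phi0_pt f H0 x = y} = 2"
proof -
  obtain x where x: "x \<in> A" "y = ovoid_of x" using elliptic_ovoid_eq_ovoid_of[OF assms] .
  have "ovoid_of v = ovoid_of x \<longleftrightarrow> v = x \<or> v = x + n0" if "v \<in> A" for v
    using ovoid_of_eq_iff[OF x(1) that] by metis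
  then have "{v \<in> pt ` A. phi0_pt f H0 v = y} = {pt x, pt (x + n0)}"
    using x add_n0_in_A by auto
  moreover have "pt x \<noteq> pt (x + n0)"
    using pt_A_inj[OF x(1) add_n0_in_A[OF x(1)]] by (metis add_cancel_left_right n0_nonzero)
  ultimately show ?thesis by (simp add: aff_points_eq)
qed

text \<open>Fix a member \<open>X\<close> of the rosette. Every lift passes through a point over
  \<open>X\<close>, that is, through \<open>x\<close> or \<open>x + n0\<close>, and through each of
  these there is exactly one lift.\<close>

lemma line_fibre:
  assumes "m \<in> rosettes f H0"
  shows "card {l \<in> aff_lines f H0. phi0_line f H0 l = m} = 2"
proof -
  obtain P where R: "rosette_at f H0 P m" using assms by (auto simp: rosettes_def)
  obtain X where X: "X \<in> m" using rosette_nonempty[OF R] .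
  then have "X \<in> elliptic_ovoids f H0" using R by (auto simp: rosette_at_def)
  then obtain x where x: "x \<in> A" "X = ovoid_of x" by (rule elliptic_ovoid_eq_ovoid_of)
  let ?x' = "x + n0"
  have x': "?x' \<in> A" "ovoid_of ?x' = X"
    using x add_n0_in_A ovoid_of_eq_iff[of x ?x'] by auto
  obtain p where p: "p \<in> Z" "B x p = 0" "P = pt p" "m = phi0_line f H0 (aff_line x p)"
    using rosette_through_ovoid_of[OF R x(1)] X x(2) by blast
  obtain r where r: "r \<in> Z" "B ?x' r = 0" "P = pt r" "m = phi0_line f H0 (aff_line ?x' r)"
    using rosette_through_ovoid_of[OF R x'(1)] X x'(2) by blast
  have "l = aff_line x p \<or> l = aff_line ?x' r"
    if l: "l \<in> aff_lines f H0" "phi0_line f H0 l = m" for l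
  proof -
    obtain z where z: "pt z \<in> l" "z \<in> A" "ovoid_of z = X"
      using l X unfolding phi0_line_def aff_lines_eq using aff_line_subset by blast
    obtain s where s: "s \<in> Z" "B z s = 0" "l = aff_line z s"
      using aff_line_through[OF l(1) z(1,2)] .
    have "z = x \<or> z = ?x'" using ovoid_of_eq_iff[OF x(1) z(2)] x(2) z(3) by simp
    then show ?thesis
      using s l(2) p r x(1) x'(1) phi0_line_inj by metis
  qed
  moreover have "aff_line x p \<in> aff_lines f H0" "aff_line ?x' r \<in> aff_lines f H0"
    using aff_lines_eq x(1) x'(1) p r by blast+
  ultimately have "{l \<in> aff_lines f H0. phi0_line f H0 l = m} = {aff_line x p, aff_line ?x' r}"
    using p(4) r(4) by blast
  \<comment> \<open>A common line would contain both \<open>x\<close> and \<open>x + n0\<close>,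
    making \<open>n0\<close> a multiple of the singular vector \<open>p\<close>.\<close>
  moreover have "aff_line x p \<noteq> aff_line ?x' r"
  proof
    assume eq: "aff_line x p = aff_line ?x' r"
    have "pt ?x' \<in> aff_line ?x' r" unfolding aff_line_def by (rule range_eqI[of _ _ 0]) simp
    then obtain t where "?x' = x + t *s p"
      using pt_in_aff_line[OF x'(1) x(1) p(1,2)] eq by metis
    then have "n0 = t *s p" by simp
    moreover have "f (t *s p) = 0" using p(1) by (simp add: Z_def)
    ultimately have "f n0 = 0" by simp
    then show False by simp
  qed
  ultimately show ?thesis by simp
qed

lemma quadric_line_image:
  assumes "l \<in> quadric_lines f" "\<not> l \<subseteq> Q0 f H0"
  shows "\<exists>p. l \<inter> Q0 f H0 = {p} \<and> rosette_at f H0 p (phi0_line f H0 (l - Q0 f H0))"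
proof -
  obtain x p where xp: "x \<in> A" "p \<in> Z" "B x p = 0" and l: "l = pts_in (vec.span {x, p})"
    using quadric_line_cases[OF assms] .
  show ?thesis
    unfolding l span_pair_line(3,4)[OF xp] using rosette_at_aff_line[OF xp] by blast
qed

lemma phi0_covering:
  "geom_covering (aff_points f H0) (aff_lines f H0) (\<in>)
     (elliptic_ovoids f H0) (rosettes f H0) (\<in>) (phi0_pt f H0) (phi0_line f H0)"
proof -
  have "geom_morphism (aff_points f H0) (aff_lines f H0) (\<in>)
     (elliptic_ovoids f H0) (rosettes f H0) (\<in>) (phi0_pt f H0) (phi0_line f H0)"
    unfolding geom_morphism_def
  proof (intro conjI ballI impI)
    show "phi0_pt f H0 x \<in> elliptic_ovoids f H0" if "x \<in> aff_points f H0" for x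
      using that ovoid_of_in_elliptic_ovoids by (auto simp: aff_points_eq)
    show "phi0_line f H0 l \<in> rosettes f H0" if "l \<in> aff_lines f H0" for l
      using that rosette_at_aff_line unfolding aff_lines_eq rosettes_def by blast
  qed (simp add: phi0_line_def)
  moreover have "\<forall>x\<in>aff_points f H0. bij_betw (phi0_line f H0) {l \<in> aff_lines f H0. x \<in> l}
      {m \<in> rosettes f H0. phi0_pt f H0 x \<in> m}"
    using lines_correspond by (auto simp: aff_points_eq)
  ultimately show ?thesis
    using points_correspond by (simp add: geom_covering_def)
qed

end

theorem theorem1:
  fixes f :: "('a::{field,finite}) ^ 6 \<Rightarrow> 'a" and H0 :: "('a ^ 6) set" and n :: nat
  assumes q: "CARD('a) = 2 ^ n" and n: "n \<ge> 1"
    and qf: "is_quadratic_form f"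
    and nd: "\<forall>u. (\<forall>v. polar f u v = 0) \<longrightarrow> u = 0"
    and witt: "witt_index_on f UNIV 2"
    and H0: "vec.subspace H0" "vec.dim H0 = 5"
    and par: "nondeg_on f H0"
  shows "(\<forall>x\<in>aff_points f H0. phi0_pt f H0 x \<in> elliptic_ovoids f H0)
     \<and> (\<forall>l\<in>quadric_lines f. \<not> l \<subseteq> Q0 f H0 \<longrightarrow>
          (\<exists>p. l \<inter> Q0 f H0 = {p} \<and> rosette_at f H0 p (phi0_line f H0 (l - Q0 f H0))))
     \<and> geom_covering (aff_points f H0) (aff_lines f H0) (\<in>)
          (elliptic_ovoids f H0) (rosettes f H0) (\<in>) (phi0_pt f H0) (phi0_line f H0)
     \<and> two_fold (aff_points f H0) (aff_lines f H0)
          (elliptic_ovoids f H0) (rosettes f H0) (phi0_pt f H0) (phi0_line f H0)"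
proof -
  interpret char2_quadratic_form "TYPE('a)" f
    by unfold_locales (use char2_of_card[OF q] qf nd in auto)
  obtain n0 where n0: "f n0 = 1" "H0 = {v. polar f n0 v = 0}"
    using hyperplane_nucleus[OF H0 par] .
  interpret elliptic_hyperplane "TYPE('a)" f H0 n0
    by unfold_locales (use witt n0 in auto)
  have "\<forall>x\<in>aff_points f H0. phi0_pt f H0 x \<in> elliptic_ovoids f H0"
    using phi0_covering unfolding geom_covering_def geom_morphism_def by blast
  moreover have "two_fold (aff_points f H0) (aff_lines f H0)
      (elliptic_ovoids f H0) (rosettes f H0) (phi0_pt f H0) (phi0_line f H0)"
    using point_fibre line_fibre by (simp add: two_fold_def)
  ultimately show ?thesis using quadric_line_image phi0_covering by blast
qed

end
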